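(* Let $A\subset\mathbb R^q$ be a Borel set with $p_A:=\mathbb P(\mathbf Z\in A)>0$ and assume Condition (C) below holds. Then $$\sup_{\mathbf u\in[0,1]^p}\big|\overline{\mathbb D}_n(\mathbf u,A)-\widetilde{\mathbb D}_n(\mathbf u,A)\big|\longrightarrow 0\quad\text{in probability as } n\to\infty,$$ where $$\widetilde{\mathbb D}_n(\mathbf u,A):=\mathbb D_n(\mathbf u,A)-p_A^{-1}\sum_{k=1}^p\partial_kD(\mathbf u,A)\Big(\mathbb D_n\big((u_k,\mathbf 1_{-k}),A\big)-u_k\,\mathbb D_n(\mathbf 1,A)\Big).$$
   Context: Let $(\mathbf X,\mathbf Z)$ be a random vector in $\mathbb R^p\times\mathbb R^q$ and $(\mathbf X_1,\mathbf Z_1),\dots,(\mathbf X_n,\mathbf Z_n)$ i.i.d. copies of it. Vector inequalities are componentwise. For a Borel set $A$ with $p_A>0$, the conditional margins $F_k(t|A):=\mathbb P(X_k\le t\mid \mathbf Z\in A)$, $k=1,\dots,p$, are assumed continuous (standing assumption). Let $U^A_k:=F_k(X_k|A)$, $\mathbf U^A=(U^A_1,\dots,U^A_p)$, $U^A_{i,k}:=F_k(X_{i,k}|A)$, $\mathbf U^A_i=(U^A_{i,1},\dots,U^A_{i,p})$, and $D(\mathbf u,A):=\mathbb P(\mathbf U^A\le\mathbf u,\mathbf Z\in A)$ for $\mathbf u\in[0,1]^p$. Let $n_A:=\sum_{i=1}^n\mathbf 1(\mathbf Z_i\in A)$, $D_n(\mathbf u,A):=n^{-1}\sum_{i=1}^n\mathbf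 1(\mathbf U^A_i\le\mathbf u,\mathbf Z_i\in A)$, $\mathbb D_n(\mathbf u,A):=\sqrt n(D_n-D)(\mathbf u,A)$, $G_{n,k}(u|A):=n_A^{-1}\sum_{i=1}^n\mathbf 1(U^A_{i,k}\le u,\mathbf Z_i\in A)$ (set to $0$ if $n_A=0$), with generalized inverse $G^{-1}(u):=\inf\{t: G(t)\ge u\}$, $\overline D_n(\mathbf u,A):=n^{-1}\sum_{i=1}^n\mathbf 1\big(U^A_{i,k}\le G_{n,k}^{-1}(u_k|A)\ \forall k,\ \mathbf Z_i\in A\big)$, and $\overline{\mathbb D}_n(\mathbf u,A):=\sqrt n(\overline D_n-D)(\mathbf u,A)$. The vector $(u_k,\mathbf 1_{-k})$ has $k$-th coordinate $u_k$ and all other coordinates equal to $1$; $\mathbf 1=(1,\dots,1)$. $\partial_kD(\mathbf u,A)$ is the partial derivative of $\mathbf u\mapsto D(\mathbf u,A)$ w.r.t. $u_k$. Condition (C): for every $k\in\{1,\dots,p\}$, $\partial_kD(\cdot,A)$ exists and is continuous on $V_k:=\{\mathbf u\in[0,1]^p:0<u_k<1\}$. *)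

theory Defs
  imports "HOL-Probability.Probability"
begin

text \<open>The sample is given by sequences X i, Z i (i = 0,1,2,...); the generic vector
(X, Z) is taken to be (X 0, Z 0), which has the common law.  Population quantities
are therefore expressed via index 0.\<close>

definition pA :: "'a measure \<Rightarrow> (nat \<Rightarrow> 'a \<Rightarrow> real^'q) \<Rightarrow> (real^'q) set \<Rightarrow> real" where
  "pA M Z A = measure M {\<omega>\<in>space M. Z 0 \<omega> \<in> A}"

definition condF :: "'a measure \<Rightarrow> (nat \<Rightarrow> 'a \<Rightarrow> real^'p) \<Rightarrow> (nat \<Rightarrow> 'a \<Rightarrow> real^'q)
    \<Rightarrow> (real^'q) set \<Rightarrow> 'p \<Rightarrow> real \<Rightarrow> real" where
  "condF M X Z A k t = measure M {\<omega>\<in>space M. X 0 \<omega> $ k \<le> t \<and> Z 0 \<omega> \<in> A} / pA M Z A"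

definition UA :: "'a measure \<Rightarrow> (nat \<Rightarrow> 'a \<Rightarrow> real^'p) \<Rightarrow> (nat \<Rightarrow> 'a \<Rightarrow> real^'q)
    \<Rightarrow> (real^'q) set \<Rightarrow> nat \<Rightarrow> 'a \<Rightarrow> real^'p" where
  "UA M X Z A i \<omega> = (\<chi> k. condF M X Z A k (X i \<omega> $ k))"

definition DA :: "'a measure \<Rightarrow> (nat \<Rightarrow> 'a \<Rightarrow> real^'p) \<Rightarrow> (nat \<Rightarrow> 'a \<Rightarrow> real^'q)
    \<Rightarrow> (real^'q) set \<Rightarrow> real^'p \<Rightarrow> real" where
  "DA M X Z A u = measure M {\<omega>\<in>space M. (\<forall>k. UA M X Z A 0 \<omega> $ k \<le> u $ k) \<and> Z 0 \<omega> \<in> A}"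

definition vupd :: "real^'p \<Rightarrow> 'p \<Rightarrow> real \<Rightarrow> real^'p" where
  "vupd u k t = (\<chi> j. if j = k then t else u $ j)"

definition unitcube :: "(real^'p) set" where
  "unitcube = {u. \<forall>j. 0 \<le> u $ j \<and> u $ j \<le> 1}"

definition Vk :: "'p \<Rightarrow> (real^'p) set" where
  "Vk k = {u\<in>unitcube. 0 < u $ k \<and> u $ k < 1}"

definition dD :: "'a measure \<Rightarrow> (nat \<Rightarrow> 'a \<Rightarrow> real^'p) \<Rightarrow> (nat \<Rightarrow> 'a \<Rightarrow> real^'q)
    \<Rightarrow> (real^'q) set \<Rightarrow> 'p \<Rightarrow> real^'p \<Rightarrow> real" where
  "dD M X Z A k u = deriv (\<lambda>t. DA M X Z A (vupd u k t)) (u $ k)"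

definition condC :: "'a measure \<Rightarrow> (nat \<Rightarrow> 'a \<Rightarrow> real^'p) \<Rightarrow> (nat \<Rightarrow> 'a \<Rightarrow> real^'q)
    \<Rightarrow> (real^'q) set \<Rightarrow> bool" where
  "condC M X Z A \<longleftrightarrow> (\<forall>k.
     (\<forall>u\<in>Vk k. (\<lambda>t. DA M X Z A (vupd u k t)) differentiable (at (u $ k)))
     \<and> continuous_on (Vk k) (dD M X Z A k))"

definition nA :: "(nat \<Rightarrow> 'a \<Rightarrow> real^'q) \<Rightarrow> (real^'q) set \<Rightarrow> nat \<Rightarrow> 'a \<Rightarrow> nat" where
  "nA Z A n \<omega> = card {i\<in>{..<n}. Z i \<omega> \<in> A}"

text \<open>Empirical D_n(u, A) (indices i = 0..n-1 play the role of 1..n).\<close>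
definition Dn :: "'a measure \<Rightarrow> (nat \<Rightarrow> 'a \<Rightarrow> real^'p) \<Rightarrow> (nat \<Rightarrow> 'a \<Rightarrow> real^'q)
    \<Rightarrow> (real^'q) set \<Rightarrow> nat \<Rightarrow> real^'p \<Rightarrow> 'a \<Rightarrow> real" where
  "Dn M X Z A n u \<omega> = real (card {i\<in>{..<n}. (\<forall>k. UA M X Z A i \<omega> $ k \<le> u $ k) \<and> Z i \<omega> \<in> A}) / real n"

definition DDn :: "'a measure \<Rightarrow> (nat \<Rightarrow> 'a \<Rightarrow> real^'p) \<Rightarrow> (nat \<Rightarrow> 'a \<Rightarrow> real^'q)
    \<Rightarrow> (real^'q) set \<Rightarrow> nat \<Rightarrow> real^'p \<Rightarrow> 'a \<Rightarrow> real" where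
  "DDn M X Z A n u \<omega> = sqrt (real n) * (Dn M X Z A n u \<omega> - DA M X Z A u)"

definition Gn :: "'a measure \<Rightarrow> (nat \<Rightarrow> 'a \<Rightarrow> real^'p) \<Rightarrow> (nat \<Rightarrow> 'a \<Rightarrow> real^'q)
    \<Rightarrow> (real^'q) set \<Rightarrow> nat \<Rightarrow> 'p \<Rightarrow> 'a \<Rightarrow> real \<Rightarrow> real" where
  "Gn M X Z A n k \<omega> t = (if nA Z A n \<omega> = 0 then 0 else
     real (card {i\<in>{..<n}. UA M X Z A i \<omega> $ k \<le> t \<and> Z i \<omega> \<in> A}) / real (nA Z A n \<omega>))"

text \<open>Generalized inverse G^{-1}(u) = inf {t. G(t) \<ge> u}, valued in the extended reals
  (so that inf of all reals is -\<infinity> and inf of the empty set is +\<infinity>).\<close>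
definition Gninv :: "'a measure \<Rightarrow> (nat \<Rightarrow> 'a \<Rightarrow> real^'p) \<Rightarrow> (nat \<Rightarrow> 'a \<Rightarrow> real^'q)
    \<Rightarrow> (real^'q) set \<Rightarrow> nat \<Rightarrow> 'p \<Rightarrow> 'a \<Rightarrow> real \<Rightarrow> ereal" where
  "Gninv M X Z A n k \<omega> v = Inf (ereal ` {t. v \<le> Gn M X Z A n k \<omega> t})"

definition Dbarn :: "'a measure \<Rightarrow> (nat \<Rightarrow> 'a \<Rightarrow> real^'p) \<Rightarrow> (nat \<Rightarrow> 'a \<Rightarrow> real^'q)
    \<Rightarrow> (real^'q) set \<Rightarrow> nat \<Rightarrow> real^'p \<Rightarrow> 'a \<Rightarrow> real" where
  "Dbarn M X Z A n u \<omega> = real (card {i\<in>{..<n}.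
      (\<forall>k. ereal (UA M X Z A i \<omega> $ k) \<le> Gninv M X Z A n k \<omega> (u $ k)) \<and> Z i \<omega> \<in> A}) / real n"

definition DDbarn :: "'a measure \<Rightarrow> (nat \<Rightarrow> 'a \<Rightarrow> real^'p) \<Rightarrow> (nat \<Rightarrow> 'a \<Rightarrow> real^'q)
    \<Rightarrow> (real^'q) set \<Rightarrow> nat \<Rightarrow> real^'p \<Rightarrow> 'a \<Rightarrow> real" where
  "DDbarn M X Z A n u \<omega> = sqrt (real n) * (Dbarn M X Z A n u \<omega> - DA M X Z A u)"

definition DDtilden :: "'a measure \<Rightarrow> (nat \<Rightarrow> 'a \<Rightarrow> real^'p) \<Rightarrow> (nat \<Rightarrow> 'a \<Rightarrow> real^'q)
    \<Rightarrow> (real^'q) set \<Rightarrow> nat \<Rightarrow> real^'p \<Rightarrow> 'a \<Rightarrow> real" where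
  "DDtilden M X Z A n u \<omega> = DDn M X Z A n u \<omega>
     - (1 / pA M Z A) * (\<Sum>k\<in>UNIV. dD M X Z A k u *
         (DDn M X Z A n (vupd (vec 1) k (u $ k)) \<omega> - u $ k * DDn M X Z A n (vec 1) \<omega>))"

text \<open>Convergence to 0 in (outer) probability of a sequence of nonnegative real
  functions, not assumed measurable: for all \<epsilon>, \<delta> > 0, eventually the event
  {S n > \<epsilon>} is covered by a measurable set of probability < \<delta>.\<close>
definition to_zero_in_outer_prob :: "'a measure \<Rightarrow> (nat \<Rightarrow> 'a \<Rightarrow> real) \<Rightarrow> bool" where
  "to_zero_in_outer_prob M S \<longleftrightarrow> (\<forall>\<epsilon>>0. \<forall>\<delta>>0. \<exists>N. \<forall>n\<ge>N.
     \<exists>B\<in>sets M. {\<omega>\<in>space M. \<bar>S n \<omega>\<bar> > \<epsilon>} \<subseteq> B \<and> measure M B < \<delta>)"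

end

theory Submission
  imports Defs
begin

text \<open>
  Put \<open>S u = {(x, z). (\<forall>k. F\<^sub>k(x\<^sub>k | A) \<le> u\<^sub>k) \<and> z \<in> A}\<close>. Then \<open>DDn\<close> is the empirical process
  of the i.i.d. pairs \<open>(X\<^sub>i, Z\<^sub>i)\<close> over the sets \<open>S u\<close>. Since the conditional margins are
  continuous, \<open>S u - S v\<close> has probability at most \<open>p\<^sub>A \<Sum>\<^sub>k \<bar>u\<^sub>k - v\<^sub>k\<bar>\<close>, and chaining with Bernstein's
  inequality along grids of mesh \<open>16\<^sup>-\<^sup>j\<close> shows that the process is asymptotically uniformly
  equicontinuous. It vanishes almost surely on the faces \<open>u\<^sub>k = 0\<close>, so it is also stochastically bounded.

  On the event where the process has a small modulus and a bound \<open>K\<close>, everything is deterministic.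
  With \<open>v\<^sub>k = G\<^sub>n\<^sub>k\<^sup>-\<^sup>1(u\<^sub>k)\<close> and \<open>\<gamma>\<^sub>k = DDn(u\<^sub>k, 1) - u\<^sub>k DDn(1)\<close>, inverting \<open>G\<^sub>n\<^sub>k\<close> gives
  \<open>p\<^sub>A \<surd>n (v\<^sub>k - u\<^sub>k) \<approx> - \<gamma>\<^sub>k\<close>; ties are harmless because the modulus bounds the jumps of the process.
  The process \<open>DDbarn(u)\<close> equals \<open>DDn(v) + \<surd>n (D(v) - D(u))\<close>, where \<open>DDn(v) \<approx> DDn(u)\<close>, and
  \<open>D(v) - D(u)\<close> is expanded one coordinate at a time by the mean value theorem. The derivative
  \<open>\<partial>\<^sub>kD\<close> is uniformly continuous only away from \<open>u\<^sub>k \<in> {0, 1}\<close>, but near these faces \<open>\<gamma>\<^sub>k\<close> itself is small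
  and \<open>D\<close> is Lipschitz, so both terms are negligible.
\<close>

section \<open>Empirical processes of i.i.d. sequences\<close>

text \<open>For negative arguments, with \<open>x = - y\<close>, the product
  \<open>(1 + x) * (1 - x + x\<^sup>2)\<close> is \<open>1 + x ^ 3\<close>, hence at least one, and
  \<open>1 + x\<close> is at most \<open>exp x\<close>.\<close>

lemma exp_le_quadratic:
  fixes y :: real
  assumes "\<bar>y\<bar> \<le> 1"
  shows "exp y \<le> 1 + y + y\<^sup>2"
proof (cases "0 \<le> y")
  case True
  then show ?thesis using assms exp_bound by auto
next
  case False
  define x where "x = - y"
  have x: "0 \<le> x" "x \<le> 1" using False assms by (auto simp: x_def)
  have "1 \<le> (1 + x) * (1 - x + x\<^sup>2)"
    using x by (simp add: algebra_simps power2_eq_square)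
  also have "\<dots> \<le> exp x * (1 - x + x\<^sup>2)"
    using x exp_ge_add_one_self[of x] by (intro mult_right_mono) auto
  finally have "exp (- x) \<le> 1 - x + x\<^sup>2"
    by (simp add: exp_minus divide_simps mult.commute)
  then show ?thesis by (simp add: x_def)
qed

locale iid_sequence = prob_space M for M :: "'a measure" +
  fixes N :: "'b measure" and T :: "nat \<Rightarrow> 'a \<Rightarrow> 'b"
  assumes indep: "indep_vars (\<lambda>_. N) T UNIV"
    and ident: "\<And>i. distr M N (T i) = distr M N (T 0)"
begin

definition hit :: "'b set \<Rightarrow> real" where
  "hit S = prob {\<omega>\<in>space M. T 0 \<omega> \<in> S}"

definition emp :: "nat \<Rightarrow> 'b set \<Rightarrow> 'a \<Rightarrow> real" where
  "emp n S \<omega> = sqrt (real n) * (real (card {i\<in>{..<n}. T i \<omega> \<in> S}) / real n - hit S)"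

lemma T_measurable [measurable]: "T i \<in> measurable M N"
  using indep by (auto simp: indep_vars_def)

lemma prob_T:
  assumes "S \<in> sets N"
  shows "prob {\<omega>\<in>space M. T i \<omega> \<in> S} = hit S"
proof -
  have *: "prob {\<omega>\<in>space M. T j \<omega> \<in> S} = measure (distr M N (T j)) S" for j
    using assms by (subst measure_distr) (auto simp: vimage_def Int_def conj_commute)
  show ?thesis unfolding hit_def * ident[of i] ..
qed

lemma hit_mono:
  assumes "S \<in> sets N" "S' \<in> sets N" "S \<subseteq> S'"
  shows "hit S \<le> hit S'"
  unfolding hit_def using assms by (intro finite_measure_mono) auto

lemma hit_diff:
  assumes "S \<in> sets N" "S' \<in> sets N" "S \<subseteq> S'"
  shows "hit (S' - S) = hit S' - hit S"
proof -
  have "{\<omega>\<in>space M. T 0 \<omega> \<in> S' - S} = {\<omega>\<in>space M. T 0 \<omega> \<in> S'} - {\<omega>\<in>space M. T 0 \<omega> \<in> S}"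
    by auto
  then show ?thesis
    unfolding hit_def using assms by (simp, intro finite_measure_Diff) auto
qed

lemma hit_diff_le:
  assumes [measurable]: "S \<in> sets N" "S' \<in> sets N"
  shows "hit S - hit S' \<le> hit (S - S')"
proof -
  have "hit S \<le> prob ({\<omega>\<in>space M. T 0 \<omega> \<in> S'} \<union> {\<omega>\<in>space M. T 0 \<omega> \<in> S - S'})"
    unfolding hit_def by (intro finite_measure_mono) auto
  also have "\<dots> \<le> hit S' + hit (S - S')"
    unfolding hit_def by (intro measure_Un_le) auto
  finally show ?thesis by simp
qed

lemma emp_borel_measurable [measurable]:
  assumes [measurable]: "S \<in> sets N"
  shows "emp n S \<in> borel_measurable M"
proof -
  have "real (card {i\<in>{..<n}. T i \<omega> \<in> S}) = (\<Sum>i<n. indicator S (T i \<omega>))" for \<omega>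
    by (simp add: indicator_def sum.If_cases Int_def)
  then show ?thesis unfolding emp_def by simp
qed

text \<open>The square of a difference of two indicators is the indicator of the symmetric
  difference. So the exponent measures how much the two sets differ, not how large they are, and
  this is what chaining exploits.\<close>

lemma emp_mgf_bound:
  assumes [measurable]: "S \<in> sets N" "S' \<in> sets N"
    and l: "0 \<le> l" "l \<le> 1"
  shows "expectation (\<lambda>\<omega>. exp (l * (indicator S (T i \<omega>) - indicator S' (T i \<omega>) - (hit S - hit S'))))
           \<le> exp (l\<^sup>2 * (hit (S - S') + hit (S' - S)))"
proof -
  let ?Y = "\<lambda>\<omega>. indicator S (T i \<omega>) - indicator S' (T i \<omega>) :: real"
  let ?V = "\<lambda>\<omega>. indicator (S - S') (T i \<omega>) + indicator (S' - S) (T i \<omega>) :: real"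
  define m where "m = hit S - hit S'"
  have ex: "expectation (\<lambda>\<omega>. indicator R (T i \<omega>) :: real) = hit R" if [measurable]: "R \<in> sets N" for R
  proof -
    have "expectation (\<lambda>\<omega>. indicator R (T i \<omega>) :: real) = expectation (indicator {\<omega>\<in>space M. T i \<omega> \<in> R})"
      by (intro Bochner_Integration.integral_cong) (auto simp: indicator_def)
    then show ?thesis using prob_T[OF that] by simp
  qed
  have int: "integrable M (\<lambda>\<omega>. indicator R (T i \<omega>) :: real)" if [measurable]: "R \<in> sets N" for R
    by (rule integrable_const_bound[where B=1]) auto
  have pw: "exp (l * ?Y \<omega>) \<le> 1 + l * ?Y \<omega> + l\<^sup>2 * ?V \<omega>" for \<omega>
  proof -
    have "exp (l * ?Y \<omega>) \<le> 1 + l * ?Y \<omega> + (l * ?Y \<omega>)\<^sup>2"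
      using l by (intro exp_le_quadratic) (auto simp: indicator_def)
    also have "(l * ?Y \<omega>)\<^sup>2 = l\<^sup>2 * ?V \<omega>"
      by (auto simp: indicator_def power_mult_distrib)
    finally show ?thesis .
  qed
  have inte: "integrable M (\<lambda>\<omega>. exp (l * ?Y \<omega>))"
  proof (rule integrable_const_bound[where B="exp 1"])
    have "l * ?Y \<omega> \<le> 1" for \<omega> using l by (auto simp: indicator_def)
    then show "AE \<omega> in M. norm (exp (l * ?Y \<omega>)) \<le> exp 1" by simp
  qed measurable
  have "expectation (\<lambda>\<omega>. exp (l * ?Y \<omega>)) \<le> expectation (\<lambda>\<omega>. 1 + l * ?Y \<omega> + l\<^sup>2 * ?V \<omega>)"
    by (intro integral_mono inte pw Bochner_Integration.integrable_add integrable_const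
        integrable_mult_right Bochner_Integration.integrable_diff int) auto
  also have "\<dots> = 1 + l * m + l\<^sup>2 * (hit (S - S') + hit (S' - S))"
    using int[of S] int[of S'] int[of "S - S'"] int[of "S' - S"] ex[of S] ex[of S'] ex[of "S - S'"] ex[of "S' - S"]
    by (simp add: m_def prob_space)
  also have "\<dots> \<le> exp (l * m + l\<^sup>2 * (hit (S - S') + hit (S' - S)))"
    using exp_ge_add_one_self[of "l * m + l\<^sup>2 * (hit (S - S') + hit (S' - S))"]
    by (simp only: add.assoc)
  finally have *: "expectation (\<lambda>\<omega>. exp (l * ?Y \<omega>)) \<le> exp (l * m) * exp (l\<^sup>2 * (hit (S - S') + hit (S' - S)))"
    by (simp add: exp_add)
  have "expectation (\<lambda>\<omega>. exp (l * (?Y \<omega> - m))) = expectation (\<lambda>\<omega>. exp (- l * m) * exp (l * ?Y \<omega>))"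
    by (intro Bochner_Integration.integral_cong) (auto simp: algebra_simps simp flip: exp_add)
  also have "\<dots> = exp (- l * m) * expectation (\<lambda>\<omega>. exp (l * ?Y \<omega>))"
    by simp
  also have "\<dots> \<le> exp (- l * m) * (exp (l * m) * exp (l\<^sup>2 * (hit (S - S') + hit (S' - S))))"
    by (intro mult_left_mono *) auto
  also have "\<dots> = exp (l\<^sup>2 * (hit (S - S') + hit (S' - S)))"
    by (simp flip: exp_add)
  finally show ?thesis by (simp add: m_def)
qed

lemma emp_diff_sum:
  assumes "n > 0"
  shows "sqrt (real n) * (emp n S \<omega> - emp n S' \<omega>) =
    (\<Sum>i<n. indicator S (T i \<omega>) - indicator S' (T i \<omega>) - (hit S - hit S'))"
proof -
  have "real (card {i\<in>{..<n}. T i \<omega> \<in> R}) = (\<Sum>i<n. indicator R (T i \<omega>))" for R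
    by (simp add: indicator_def sum.If_cases Int_def)
  then show ?thesis unfolding emp_def using assms
    by (simp add: sum_subtractf right_diff_distrib[symmetric] mult.assoc[symmetric])
       (simp add: field_simps)
qed

text \<open>Chernoff's method: Markov's inequality for the exponential, factorised by independence.
  The parameter \<open>s\<close> is left free for later choice; \<open>s \<le> sqrt (real n)\<close>
  keeps \<open>l\<close> at most one, as \<open>emp_mgf_bound\<close> requires.\<close>

lemma emp_bernstein_one_sided:
  assumes [measurable]: "S \<in> sets N" "S' \<in> sets N"
    and n: "n > 0" and s: "0 < s" "s \<le> sqrt (real n)"
    and v: "hit (S - S') + hit (S' - S) \<le> v"
  shows "prob {\<omega>\<in>space M. x \<le> emp n S \<omega> - emp n S' \<omega>} \<le> exp (s\<^sup>2 * v - s * x)"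
proof -
  define l where "l = s / sqrt (real n)"
  have l: "0 < l" "l \<le> 1" using s n by (auto simp: l_def)
  define Y where "Y i \<omega> = exp (l * (indicator S (T i \<omega>) - indicator S' (T i \<omega>) - (hit S - hit S')))" for i \<omega>
  have ind: "indep_vars (\<lambda>_. borel) Y {..<n}"
    unfolding Y_def
    by (intro indep_vars_compose2[OF indep_vars_subset[OF indep],
      where Y="\<lambda>i t. exp (l * (indicator S t - indicator S' t - (hit S - hit S')))"]) auto
  have Yint: "integrable M (Y i)" for i
  proof (rule integrable_const_bound[where B="exp (l * (1 - (hit S - hit S')))"])
    have "Y i \<omega> \<le> exp (l * (1 - (hit S - hit S')))" for \<omega>
      unfolding Y_def exp_le_cancel_iff using l by (intro mult_left_mono) (auto simp: indicator_def)
    then show "AE \<omega> in M. norm (Y i \<omega>) \<le> exp (l * (1 - (hit S - hit S')))"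
      by (auto simp: Y_def)
  qed (unfold Y_def, measurable)
  have prodY: "(\<Prod>i<n. Y i \<omega>) = exp (s * (emp n S \<omega> - emp n S' \<omega>))" for \<omega>
  proof -
    have "(\<Prod>i<n. Y i \<omega>) = exp (l * (sqrt (real n) * (emp n S \<omega> - emp n S' \<omega>)))"
      unfolding Y_def emp_diff_sum[OF n] sum_distrib_left by (simp add: exp_sum)
    also have "l * (sqrt (real n) * (emp n S \<omega> - emp n S' \<omega>)) = s * (emp n S \<omega> - emp n S' \<omega>)"
      using n by (simp add: l_def)
    finally show ?thesis .
  qed
  have "prob {\<omega>\<in>space M. x \<le> emp n S \<omega> - emp n S' \<omega>}
      \<le> prob {\<omega>\<in>space M. exp (s * x) \<le> (\<Prod>i<n. Y i \<omega>)}"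
    unfolding prodY using s by (intro finite_measure_mono) auto
  also have "\<dots> \<le> expectation (\<lambda>\<omega>. \<Prod>i<n. Y i \<omega>) / exp (s * x)"
    by (intro integral_Markov_inequality_measure[where A="{}"])
       (use indep_vars_integrable[OF _ ind Yint] in \<open>auto simp: prodY\<close>)
  also have "expectation (\<lambda>\<omega>. \<Prod>i<n. Y i \<omega>) = (\<Prod>i<n. expectation (Y i))"
    by (intro indep_vars_lebesgue_integral ind Yint) auto
  also have "\<dots> \<le> (\<Prod>i<n. exp (l\<^sup>2 * v))"
  proof (intro prod_mono conjI)
    fix i
    show "0 \<le> expectation (Y i)" by (intro Bochner_Integration.integral_nonneg) (auto simp: Y_def)
    have "expectation (Y i) \<le> exp (l\<^sup>2 * (hit (S - S') + hit (S' - S)))"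
      unfolding Y_def using l by (intro emp_mgf_bound) auto
    also have "\<dots> \<le> exp (l\<^sup>2 * v)" using v by (simp add: mult_left_mono)
    finally show "expectation (Y i) \<le> exp (l\<^sup>2 * v)" .
  qed
  also have "\<dots> = exp (s\<^sup>2 * v)"
    using n by (simp add: l_def power_divide flip: exp_of_nat_mult)
  finally show ?thesis by (simp add: exp_diff divide_right_mono)
qed

lemma emp_bernstein:
  assumes [measurable]: "S \<in> sets N" "S' \<in> sets N"
    and n: "n > 0" and s: "0 < s" "s \<le> sqrt (real n)"
    and v: "hit (S - S') + hit (S' - S) \<le> v"
  shows "prob {\<omega>\<in>space M. x \<le> \<bar>emp n S \<omega> - emp n S' \<omega>\<bar>} \<le> 2 * exp (s\<^sup>2 * v - s * x)"
proof -
  have "prob {\<omega>\<in>space M. x \<le> \<bar>emp n S \<omega> - emp n S' \<omega>\<bar>} \<le>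
    prob ({\<omega>\<in>space M. x \<le> emp n S \<omega> - emp n S' \<omega>} \<union> {\<omega>\<in>space M. x \<le> emp n S' \<omega> - emp n S \<omega>})"
    by (intro finite_measure_mono) auto
  also have "\<dots> \<le> prob {\<omega>\<in>space M. x \<le> emp n S \<omega> - emp n S' \<omega>} + prob {\<omega>\<in>space M. x \<le> emp n S' \<omega> - emp n S \<omega>}"
    by (intro measure_Un_le) auto
  also have "\<dots> \<le> exp (s\<^sup>2 * v - s * x) + exp (s\<^sup>2 * v - s * x)"
    using v by (intro add_mono emp_bernstein_one_sided n s) (auto simp: add.commute)
  finally show ?thesis by simp
qed

end

section \<open>Chaining over Lipschitz-indexed sets\<close>

lemma power_le_fact_mult_exp:
  fixes x :: real
  assumes "0 \<le> x"
  shows "x ^ k \<le> fact k * exp x"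
proof -
  have "(\<Sum>n\<in>{k}. x ^ n /\<^sub>R fact n) \<le> (\<Sum>n. x ^ n /\<^sub>R fact n)"
    using assms by (intro sum_le_suminf summable_exp_generic) auto
  then have "x ^ k /\<^sub>R fact k \<le> exp x" by (simp add: exp_def)
  then show ?thesis by (simp add: field_simps)
qed

text \<open>
  The left-hand side is the union bound over pairs of neighbouring points of the grid of mesh
  \<open>16\<^sup>-\<^sup>j\<close>, where Bernstein's inequality is used with \<open>s = 4\<^sup>j\<close> at level \<open>2\<^sup>-\<^sup>j\<close>.
\<close>

lemma chaining_rate_bound:
  fixes p :: nat
  shows "\<exists>C. 0 < C \<and> (\<forall>j. ((16 ^ j + 2) ^ p)\<^sup>2 * (2 * exp (32 * real p - 2 ^ j)) \<le> C / 2 ^ j)"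
proof (intro exI conjI allI)
  let ?C = "2 * 9 ^ p * exp (32 * real p) * fact (8 * p + 1)"
  show "0 < ?C" by simp
  fix j :: nat
  define y where "y = (2::real) ^ j"
  have y: "1 \<le> y" by (simp add: y_def)
  have y4: "16 ^ j = y ^ 4"
    using power_mult[of "2::real" 4 j] power_mult[of "2::real" j 4] by (simp add: y_def mult.commute[of j 4])
  \<comment> \<open>The number of pairs grows like \<open>y ^ (8 * p)\<close>. One power more leaves
    a factor \<open>1 / y\<close>, which makes the bounds summable over the levels.\<close>
  have "y ^ (8 * p + 1) \<le> fact (8 * p + 1) * exp y"
    using y by (intro power_le_fact_mult_exp) auto
  then have *: "y ^ (8 * p) * exp (- y) \<le> fact (8 * p + 1) / y"
    using y by (simp add: exp_minus field_simps)
  have "1 \<le> y ^ 4" using y by simp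
  then have "((16 ^ j + 2) ^ p)\<^sup>2 \<le> ((3 * y ^ 4) ^ p)\<^sup>2"
    unfolding y4 by (intro power_mono) auto
  also have "\<dots> = 9 ^ p * y ^ (8 * p)"
  proof -
    have "((3 * y ^ 4) ^ p)\<^sup>2 = ((3 * y ^ 4)\<^sup>2) ^ p" by (simp only: power_mult[symmetric] mult.commute)
    also have "(3 * y ^ 4)\<^sup>2 = 9 * y ^ 8" by (simp add: power_mult_distrib)
    finally show ?thesis by (simp add: power_mult_distrib power_mult)
  qed
  finally have "((16 ^ j + 2) ^ p)\<^sup>2 * (2 * exp (32 * real p - 2 ^ j))
      \<le> 9 ^ p * y ^ (8 * p) * (2 * exp (32 * real p - y))"
    unfolding y_def by (intro mult_right_mono) auto
  also have "\<dots> = 2 * 9 ^ p * exp (32 * real p) * (y ^ (8 * p) * exp (- y))"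
    by (simp add: exp_diff exp_minus field_simps)
  also have "\<dots> \<le> 2 * 9 ^ p * exp (32 * real p) * (fact (8 * p + 1) / y)"
    by (intro mult_left_mono *) auto
  finally show "((16 ^ j + 2) ^ p)\<^sup>2 * (2 * exp (32 * real p - 2 ^ j)) \<le> ?C / 2 ^ j"
    by (simp add: y_def)
qed

lemma sum_inverse_powers_two_le: "(\<Sum>j=a..b. 1 / 2 ^ j) \<le> 2 / (2::real) ^ a"
proof (cases "a \<le> b")
  case True
  then have "(\<Sum>j=a..b. 1 / 2 ^ j) = 2 / (2::real) ^ a - 1 / 2 ^ b"
  proof (induction b rule: dec_induct)
    case (step b)
    have "(1::real) / 2 ^ b = 1 / 2 ^ Suc b + 1 / 2 ^ Suc b" by simp
    moreover have "(\<Sum>j=a..Suc b. 1 / (2::real) ^ j) = (\<Sum>j=a..b. 1 / 2 ^ j) + 1 / 2 ^ Suc b"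
      using step.hyps by simp
    ultimately show ?case using step.IH by linarith
  qed simp
  then show ?thesis by simp
qed auto

section \<open>Nested grids in the unit cube\<close>

definition grid_point :: "nat \<Rightarrow> ('p \<Rightarrow> nat) \<Rightarrow> real^'p" where
  "grid_point j m = (\<chi> k. real (m k) / 16 ^ j)"

definition grid_index :: "nat \<Rightarrow> real^'p \<Rightarrow> 'p \<Rightarrow> nat" where
  "grid_index j u k = nat \<lfloor>16 ^ j * u $ k\<rfloor>"

text \<open>The range ends one above \<open>16 ^ j\<close> so that the upper corner of every cell is
  indexed, even for points on the face where a coordinate is one.\<close>

definition grid_indices :: "nat \<Rightarrow> ('p \<Rightarrow> nat) set" where
  "grid_indices j = UNIV \<rightarrow>\<^sub>E {..16 ^ j + 1}"

lemma finite_grid_indices: "finite (grid_indices j :: ('p::finite \<Rightarrow> nat) set)"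
  unfolding grid_indices_def by (intro finite_PiE) auto

lemma card_grid_indices: "card (grid_indices j :: ('p::finite \<Rightarrow> nat) set) = (16 ^ j + 2) ^ CARD('p)"
  unfolding grid_indices_def by (subst card_funcsetE) auto

lemma grid_index_bounds:
  assumes "0 \<le> u $ k" "u $ k \<le> 1"
  shows "real (grid_index j u k) \<le> 16 ^ j * u $ k"
    and "16 ^ j * u $ k < real (grid_index j u k) + 1"
    and "grid_index j u k \<le> 16 ^ j"
proof -
  have "0 \<le> \<lfloor>16 ^ j * u $ k\<rfloor>" using assms by simp
  then have e: "real (grid_index j u k) = of_int \<lfloor>16 ^ j * u $ k\<rfloor>"
    by (simp add: grid_index_def)
  show 1: "real (grid_index j u k) \<le> 16 ^ j * u $ k" unfolding e by simp
  show "16 ^ j * u $ k < real (grid_index j u k) + 1" unfolding e by linarith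
  have "real (grid_index j u k) \<le> 16 ^ j * 1"
    by (rule order_trans[OF 1]) (use assms in \<open>intro mult_left_mono; simp\<close>)
  then have "real (grid_index j u k) \<le> real (16 ^ j)" by simp
  then show "grid_index j u k \<le> 16 ^ j" by (simp only: of_nat_le_iff)
qed

text \<open>Monotonicity serves to bracket a point between grid points, and the Lipschitz bound
  controls the variances. The index is any vector because the grid exceeds the cube by one
  step.\<close>

locale lipschitz_indexed_sets = iid_sequence M N T
  for M :: "'a measure" and N :: "'b measure" and T :: "nat \<Rightarrow> 'a \<Rightarrow> 'b" +
  fixes S :: "real^'p \<Rightarrow> 'b set"
  assumes S_sets [measurable]: "S u \<in> sets N"
    and S_mono: "(\<forall>k. u $ k \<le> v $ k) \<Longrightarrow> S u \<subseteq> S v"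
    and S_lipschitz: "hit (S u - S v) \<le> (\<Sum>k\<in>UNIV. \<bar>u $ k - v $ k\<bar>)"
begin

abbreviation process :: "nat \<Rightarrow> real^'p \<Rightarrow> 'a \<Rightarrow> real" where
  "process n u \<omega> \<equiv> emp n (S u) \<omega>"

text \<open>One step of a grid is sixteen steps of the next. The tolerance 16 thus covers both
  neighbours on one grid and the roundings of a point on two consecutive grids.\<close>

definition close_pairs :: "nat \<Rightarrow> (('p \<Rightarrow> nat) \<times> ('p \<Rightarrow> nat)) set" where
  "close_pairs j = {(m, m') \<in> grid_indices j \<times> grid_indices j. \<forall>k. \<bar>real (m k) - real (m' k)\<bar> \<le> 16}"

definition bad_level :: "nat \<Rightarrow> nat \<Rightarrow> 'a set" where
  "bad_level n j = (\<Union>(m, m') \<in> close_pairs j. {\<omega>\<in>space M.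
     1 / 2 ^ j \<le> \<bar>process n (grid_point j m) \<omega> - process n (grid_point j m') \<omega>\<bar>})"

lemma finite_close_pairs: "finite (close_pairs j)"
  by (rule finite_subset[of _ "grid_indices j \<times> grid_indices j"])
     (auto simp: close_pairs_def finite_grid_indices)

lemma card_close_pairs: "card (close_pairs j) \<le> ((16 ^ j + 2) ^ CARD('p))\<^sup>2"
proof -
  have "card (close_pairs j) \<le> card (grid_indices j \<times> grid_indices j :: (('p \<Rightarrow> nat) \<times> ('p \<Rightarrow> nat)) set)"
    by (intro card_mono) (auto simp: close_pairs_def finite_grid_indices)
  then show ?thesis by (simp add: card_cartesian_product card_grid_indices power2_eq_square)
qed

lemma bad_level_sets [measurable]: "bad_level n j \<in> sets M"
  unfolding bad_level_def by (intro sets.finite_UN finite_close_pairs) (auto split: prod.splits)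

text \<open>Symmetric differences over close pairs have probability at most
  \<open>32 * real CARD('p) / 16 ^ j\<close>. With \<open>s = 4 ^ j\<close> the variance term is
  therefore constant in \<open>j\<close>, and \<open>16 ^ j \<le> n\<close> is the condition on
  \<open>s\<close> in \<open>emp_bernstein\<close>.\<close>

lemma prob_bad_level:
  assumes n: "16 ^ j \<le> n"
  shows "prob (bad_level n j) \<le> ((16 ^ j + 2) ^ CARD('p))\<^sup>2 * (2 * exp (32 * real CARD('p) - 2 ^ j))"
proof -
  let ?E = "\<lambda>(m, m'). {\<omega>\<in>space M. 1 / 2 ^ j \<le> \<bar>process n (grid_point j m) \<omega> - process n (grid_point j m') \<omega>\<bar>}"
  have n0: "n > 0" using n by (rule less_le_trans[rotated]) simp
  have single: "prob (?E q) \<le> 2 * exp (32 * real CARD('p) - 2 ^ j)" if "q \<in> close_pairs j" for q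
  proof -
    obtain m m' where q: "q = (m, m')" by force
    let ?a = "grid_point j m :: real^'p" and ?b = "grid_point j m' :: real^'p"
    have c: "\<bar>?a $ k - ?b $ k\<bar> \<le> 16 / 16 ^ j" for k
      using that unfolding q close_pairs_def grid_point_def
      by (auto simp: diff_divide_distrib[symmetric] divide_right_mono)
    have d: "(\<Sum>k\<in>UNIV. \<bar>?a $ k - ?b $ k\<bar>) \<le> real CARD('p) * (16 / 16 ^ j)"
      using sum_bounded_above[of UNIV "\<lambda>k. \<bar>?a $ k - ?b $ k\<bar>", OF c] by simp
    have v: "hit (S ?a - S ?b) + hit (S ?b - S ?a) \<le> 32 * real CARD('p) / 16 ^ j"
      using S_lipschitz[of ?a ?b] S_lipschitz[of ?b ?a] d by (simp add: abs_minus_commute)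
    have "(4::real) ^ j = sqrt (16 ^ j)"
      by (rule real_sqrt_unique[symmetric]) (auto simp: power2_eq_square simp flip: power_mult_distrib)
    also have "\<dots> \<le> sqrt (real n)" using n
      by (metis of_nat_le_iff of_nat_numeral of_nat_power real_sqrt_le_iff)
    finally have s: "(4::real) ^ j \<le> sqrt (real n)" .
    have "prob (?E q) \<le> 2 * exp ((4 ^ j)\<^sup>2 * (32 * real CARD('p) / 16 ^ j) - 4 ^ j * (1 / 2 ^ j))"
      unfolding q prod.case by (intro emp_bernstein s v n0) auto
    also have "(4 ^ j)\<^sup>2 = (16::real) ^ j" by (simp add: power2_eq_square flip: power_mult_distrib)
    also have "(4::real) ^ j * (1 / 2 ^ j) = 2 ^ j" by (simp flip: power_divide)
    finally show ?thesis by simp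
  qed
  have "prob (bad_level n j) \<le> (\<Sum>q\<in>close_pairs j. prob (?E q))"
    unfolding bad_level_def by (intro measure_UNION_le finite_close_pairs) (auto split: prod.splits)
  also have "\<dots> \<le> real (card (close_pairs j)) * (2 * exp (32 * real CARD('p) - 2 ^ j))"
    by (intro sum_bounded_above single)
  also have "\<dots> \<le> real (((16 ^ j + 2) ^ CARD('p))\<^sup>2) * (2 * exp (32 * real CARD('p) - 2 ^ j))"
    using card_close_pairs[of j] by (intro mult_right_mono) (auto simp: of_nat_le_iff simp del: of_nat_power)
  finally show ?thesis by (simp add: add.commute)
qed

lemma process_close_grid_points:
  assumes "\<omega> \<in> space M" "\<omega> \<notin> bad_level n j" "(m, m') \<in> close_pairs j"
  shows "\<bar>process n (grid_point j m) \<omega> - process n (grid_point j m') \<omega>\<bar> \<le> 1 / 2 ^ j"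
  using assms unfolding bad_level_def by (force simp: not_le)

text \<open>The rounding of \<open>u\<close> on one grid is also a point of the next grid, with
  indices multiplied by 16, and there it is close to the finer rounding. The increments of all
  levels are then added up.\<close>

lemma process_chain:
  assumes om: "\<omega> \<in> space M" "\<And>j. j0 \<le> j \<Longrightarrow> j \<le> J \<Longrightarrow> \<omega> \<notin> bad_level n j"
    and u: "\<forall>k. 0 \<le> u $ k \<and> u $ k \<le> 1" and J: "j0 \<le> J"
  shows "\<bar>process n (grid_point J (grid_index J u)) \<omega> - process n (grid_point j0 (grid_index j0 u)) \<omega>\<bar>
     \<le> (\<Sum>j=Suc j0..J. 1 / 2 ^ j)"
  using J om(2)
proof (induction J rule: dec_induct)
  case base
  then show ?case by simp
next
  case (step j)
  let ?m = "\<lambda>k. 16 * grid_index j u k"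
  have e: "grid_point j (grid_index j u) = grid_point (Suc j) ?m"
    by (simp add: grid_point_def vec_eq_iff)
  have b: "real (grid_index j u k) \<le> 16 ^ j * u $ k" "16 ^ j * u $ k < real (grid_index j u k) + 1"
    "grid_index j u k \<le> 16 ^ j"
    "real (grid_index (Suc j) u k) \<le> 16 ^ Suc j * u $ k" "16 ^ Suc j * u $ k < real (grid_index (Suc j) u k) + 1"
    "grid_index (Suc j) u k \<le> 16 ^ Suc j" for k
    using grid_index_bounds u by blast+
  have i1: "grid_index (Suc j) u \<in> grid_indices (Suc j)"
    unfolding grid_indices_def using b(6) by (auto simp: le_Suc_eq)
  have i2: "?m \<in> grid_indices (Suc j)"
    unfolding grid_indices_def using b(3) by (auto simp: le_Suc_eq)
  have cl: "\<bar>real (grid_index (Suc j) u k) - real (?m k)\<bar> \<le> 16" for k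
    using b[of k] by (simp add: abs_le_iff)
  then have "(grid_index (Suc j) u, ?m) \<in> close_pairs (Suc j)"
    using i1 i2 by (auto simp: close_pairs_def)
  then have "\<bar>process n (grid_point (Suc j) (grid_index (Suc j) u)) \<omega> - process n (grid_point j (grid_index j u)) \<omega>\<bar>
      \<le> 1 / 2 ^ Suc j"
    unfolding e using step.prems[of "Suc j"] step.hyps om(1)
    by (intro process_close_grid_points) auto
  moreover have "\<bar>process n (grid_point j (grid_index j u)) \<omega> - process n (grid_point j0 (grid_index j0 u)) \<omega>\<bar>
     \<le> (\<Sum>i=Suc j0..j. 1 / 2 ^ i)"
    by (rule step.IH) (use step.prems in auto)
  moreover have "(\<Sum>i=Suc j0..Suc j. 1 / (2::real) ^ i) = (\<Sum>i=Suc j0..j. 1 / 2 ^ i) + 1 / 2 ^ Suc j"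
    using step.hyps by simp
  ultimately show ?case by linarith
qed

text \<open>\<open>S u\<close> lies between the sets at the two corners of its cell. Counts are
  monotone, so beyond the increment between the corners only the probability of the cell matters,
  scaled by \<open>sqrt (real n)\<close>. This reaches all points from finitely many.\<close>

lemma process_grid_round_down:
  assumes om: "\<omega> \<in> space M" "\<omega> \<notin> bad_level n J"
    and u: "\<forall>k. 0 \<le> u $ k \<and> u $ k \<le> 1"
  shows "\<bar>process n u \<omega> - process n (grid_point J (grid_index J u)) \<omega>\<bar>
     \<le> 1 / 2 ^ J + sqrt (real n) * (real CARD('p) / 16 ^ J)"
proof -
  let ?m = "grid_index J u" and ?m' = "\<lambda>k. grid_index J u k + 1"
  let ?a = "grid_point J ?m" and ?b = "grid_point J ?m'"
  have b: "real (?m k) \<le> 16 ^ J * u $ k" "16 ^ J * u $ k < real (?m k) + 1" "?m k \<le> 16 ^ J" for k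
    using grid_index_bounds u by blast+
  have le: "?a $ k \<le> u $ k" "u $ k \<le> ?b $ k" for k
    using b(1,2)[of k] by (simp_all add: grid_point_def field_simps)
  have cl: "(?m', ?m) \<in> close_pairs J"
    unfolding close_pairs_def grid_indices_def using b(3) by (auto simp: le_Suc_eq)
  have d: "\<bar>process n ?b \<omega> - process n ?a \<omega>\<bar> \<le> 1 / 2 ^ J"
    by (rule process_close_grid_points[OF om cl])
  have ab: "?b $ k - ?a $ k = 1 / 16 ^ J" for k
    by (simp add: grid_point_def field_simps)
  have h1: "S ?a \<subseteq> S u" "S u \<subseteq> S ?b" using le by (auto intro!: S_mono)
  have h: "hit (S ?b) - hit (S ?a) \<le> real CARD('p) / 16 ^ J"
    using S_lipschitz[of ?b ?a] ab h1 hit_diff[of "S ?a" "S ?b"] by simp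
  have hh: "hit (S ?a) \<le> hit (S u)" "hit (S u) \<le> hit (S ?b)"
    using h1 by (auto intro!: hit_mono)
  let ?c = "\<lambda>v. real (card {i\<in>{..<n}. T i \<omega> \<in> S v}) / real n"
  have c: "?c ?a \<le> ?c u" "?c u \<le> ?c ?b"
    using h1 by (auto intro!: divide_right_mono card_mono simp: of_nat_le_iff)
  have p: "process n v \<omega> = sqrt (real n) * (?c v - hit (S v))" for v by (simp add: emp_def)
  have "process n u \<omega> - process n ?a \<omega> \<le> process n ?b \<omega> - process n ?a \<omega> + sqrt (real n) * (real CARD('p) / 16 ^ J)"
  proof -
    have "sqrt (real n) * (?c u - hit (S u)) \<le> sqrt (real n) * ((?c ?b - hit (S ?b)) + (real CARD('p) / 16 ^ J))"
      using c hh h by (intro mult_left_mono real_sqrt_ge_zero of_nat_0_le_iff) linarith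
    then show ?thesis unfolding p by (simp only: distrib_left)
  qed
  moreover have "process n ?a \<omega> - process n u \<omega> \<le> sqrt (real n) * (real CARD('p) / 16 ^ J)"
  proof -
    have "sqrt (real n) * (?c ?a - hit (S ?a)) \<le> sqrt (real n) * ((?c u - hit (S u)) + (real CARD('p) / 16 ^ J))"
      using c hh h by (intro mult_left_mono real_sqrt_ge_zero of_nat_0_le_iff) linarith
    then show ?thesis unfolding p by (simp only: distrib_left)
  qed
  moreover have "0 \<le> 1 / (2::real) ^ J" by simp
  ultimately show ?thesis using d by linarith
qed

text \<open>Rounding each point to level \<open>j0\<close> costs \<open>2 / 2 ^ j0\<close>, half for
  the chain and half for the last bracketing; the two roundings differ by \<open>1 / 2 ^ j0\<close>.
  This gives the factor five.\<close>

lemma process_modulus_off_bad_levels: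
  assumes om: "\<omega> \<in> space M" "\<And>j. j0 \<le> j \<Longrightarrow> j \<le> J \<Longrightarrow> \<omega> \<notin> bad_level n j"
    and J: "j0 \<le> J"
    and u: "\<forall>k. 0 \<le> u $ k \<and> u $ k \<le> 1" and v: "\<forall>k. 0 \<le> v $ k \<and> v $ k \<le> 1"
    and uv: "\<forall>k. \<bar>u $ k - v $ k\<bar> \<le> 1 / 16 ^ j0"
  shows "\<bar>process n u \<omega> - process n v \<omega>\<bar> \<le> 5 / 2 ^ j0 + 2 * (sqrt (real n) * (real CARD('p) / 16 ^ J))"
proof -
  have J2: "1 / (2::real) ^ J \<le> 1 / 2 ^ j0" using J by (simp add: frac_le)
  have s: "(\<Sum>j=Suc j0..J. 1 / 2 ^ j) \<le> 1 / (2::real) ^ j0"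
    using sum_inverse_powers_two_le[of "Suc j0" J] by simp
  have one: "\<bar>process n w \<omega> - process n (grid_point j0 (grid_index j0 w)) \<omega>\<bar>
      \<le> 2 / 2 ^ j0 + sqrt (real n) * (real CARD('p) / 16 ^ J)"
    if w: "\<forall>k. 0 \<le> w $ k \<and> w $ k \<le> 1" for w
  proof -
    have "(2::real) / 2 ^ j0 = 1 / 2 ^ j0 + 1 / 2 ^ j0" by simp
    then show ?thesis
      using process_chain[OF om w J] process_grid_round_down[OF om(1) om(2)[OF J order_refl] w] s J2
      by linarith
  qed
  have bu: "real (grid_index j0 u k) \<le> 16 ^ j0 * u $ k" "16 ^ j0 * u $ k < real (grid_index j0 u k) + 1"
    "grid_index j0 u k \<le> 16 ^ j0" for k
    using grid_index_bounds u by blast+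
  have bv: "real (grid_index j0 v k) \<le> 16 ^ j0 * v $ k" "16 ^ j0 * v $ k < real (grid_index j0 v k) + 1"
    "grid_index j0 v k \<le> 16 ^ j0" for k
    using grid_index_bounds v by blast+
  have d: "\<bar>16 ^ j0 * u $ k - 16 ^ j0 * v $ k\<bar> \<le> 1" for k
  proof -
    have "\<bar>16 ^ j0 * u $ k - 16 ^ j0 * v $ k\<bar> = 16 ^ j0 * \<bar>u $ k - v $ k\<bar>"
      by (simp add: abs_mult flip: right_diff_distrib)
    also have "\<dots> \<le> 16 ^ j0 * (1 / 16 ^ j0)" using uv by (intro mult_left_mono) auto
    finally show ?thesis by simp
  qed
  have "\<bar>real (grid_index j0 u k) - real (grid_index j0 v k)\<bar> \<le> 16" for k
    using bu[of k] bv[of k] d[of k] by (simp add: abs_le_iff)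
  then have "(grid_index j0 u, grid_index j0 v) \<in> close_pairs j0"
    using bu(3) bv(3) by (auto simp: close_pairs_def grid_indices_def le_Suc_eq)
  then have "\<bar>process n (grid_point j0 (grid_index j0 u)) \<omega> - process n (grid_point j0 (grid_index j0 v)) \<omega>\<bar> \<le> 1 / 2 ^ j0"
    using om J by (intro process_close_grid_points) auto
  moreover have "(5::real) / 2 ^ j0 = 2 / 2 ^ j0 + 2 / 2 ^ j0 + 1 / 2 ^ j0"
    by (simp flip: add_divide_distrib)
  ultimately show ?thesis using one[OF u] one[OF v] by linarith
qed

text \<open>The coarsest level \<open>j0\<close> fixes both the probability of failure and the
  modulus, independently of \<open>n\<close>. A single measurable exceptional set serves all pairs
  of points, which avoids measurability of suprema.\<close>

theorem process_equicontinuous: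
  assumes eps: "0 < \<epsilon>" and eta: "0 < \<eta>"
  obtains \<delta> K where "0 < \<delta>"
    and "\<And>n. K \<le> n \<Longrightarrow> \<exists>B\<in>sets M. prob B < \<eta> \<and> (\<forall>\<omega>\<in>space M - B. \<forall>u v.
        (\<forall>k. 0 \<le> u $ k \<and> u $ k \<le> 1) \<longrightarrow> (\<forall>k. 0 \<le> v $ k \<and> v $ k \<le> 1) \<longrightarrow>
        (\<forall>k. \<bar>u $ k - v $ k\<bar> \<le> \<delta>) \<longrightarrow> \<bar>process n u \<omega> - process n v \<omega>\<bar> \<le> \<epsilon>)"
proof -
  obtain C where C: "0 < C"
    "\<And>j. ((16 ^ j + 2) ^ CARD('p))\<^sup>2 * (2 * exp (32 * real CARD('p) - 2 ^ j)) \<le> C / 2 ^ j"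
    using chaining_rate_bound[of "CARD('p)"] by auto
  have lim: "(\<lambda>j. c / 2 ^ j) \<longlonglongrightarrow> 0" for c :: real
    using tendsto_mult[OF tendsto_const LIMSEQ_inverse_realpow_zero[of 2]] by (simp add: divide_inverse)
  have "\<forall>\<^sub>F j in sequentially. 2 * C / 2 ^ j < \<eta>" "\<forall>\<^sub>F j in sequentially. 5 / 2 ^ j < \<epsilon> / 2"
    using order_tendstoD(2)[OF lim[of "2 * C"] eta] order_tendstoD(2)[OF lim[of 5], of "\<epsilon> / 2"] eps by auto
  then have "\<forall>\<^sub>F j in sequentially. 2 * C / 2 ^ j < \<eta> \<and> 5 / 2 ^ j < \<epsilon> / 2"
    by eventually_elim auto
  then obtain j0 where j0: "2 * C / 2 ^ j0 < \<eta>" "5 / 2 ^ j0 < \<epsilon> / 2"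
    by (auto simp: eventually_sequentially)
  have "(\<lambda>n. 32 * real CARD('p) / sqrt (real n)) \<longlonglongrightarrow> 0"
    by (intro real_tendsto_divide_at_top[OF tendsto_const]
      filterlim_compose[OF sqrt_at_top] filterlim_real_sequentially)
  from order_tendstoD(2)[OF this, of "\<epsilon> / 2"] eps
  obtain K0 where K0: "\<And>n. K0 \<le> n \<Longrightarrow> 32 * real CARD('p) / sqrt (real n) < \<epsilon> / 2"
    by (auto simp: eventually_sequentially)
  show ?thesis
  proof (rule that[of "1 / 16 ^ j0" "max K0 (16 ^ j0)"])
    fix n assume n: "max K0 (16 ^ j0) \<le> n"
    then have "1 \<le> n" using one_le_power[of "16::nat" j0] by linarith
    then have n0: "n > 0" by simp
    \<comment> \<open>The finest level is the last one at which Bernstein's bound applies. Its cells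
      have side below \<open>16 / n\<close>, so the bracketing error is of order
      \<open>1 / sqrt n\<close>.\<close>
    obtain J where J: "16 ^ J \<le> n" "n < 16 ^ (J + 1)"
      using ex_power_ivl1[of 16 n] \<open>1 \<le> n\<close> by auto
    have "16 ^ j0 < (16::nat) ^ (J + 1)" using n J(2) by linarith
    then have jJ: "j0 \<le> J" using power_less_imp_less_exp[of "16::nat" j0 "J + 1"] by simp
    have small: "2 * (sqrt (real n) * (real CARD('p) / 16 ^ J)) \<le> \<epsilon> / 2"
    proof -
      have "real n < 16 ^ (J + 1)"
        using J(2) by (metis of_nat_less_iff of_nat_numeral of_nat_power)
      then have "real n / 16 \<le> 16 ^ J" by simp
      then have "2 * (sqrt (real n) * (real CARD('p) / 16 ^ J)) \<le> 2 * (sqrt (real n) * (real CARD('p) / (real n / 16)))"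
        using n0 by (intro mult_left_mono divide_left_mono) auto
      also have "\<dots> = 32 * real CARD('p) / sqrt (real n)"
        using n0 by (simp add: field_simps flip: power2_eq_square)
      finally show ?thesis using K0[of n] n by simp
    qed
    let ?B = "\<Union>j\<in>{j0..J}. bad_level n j"
    show "\<exists>B\<in>sets M. prob B < \<eta> \<and> (\<forall>\<omega>\<in>space M - B. \<forall>u v.
        (\<forall>k. 0 \<le> u $ k \<and> u $ k \<le> 1) \<longrightarrow> (\<forall>k. 0 \<le> v $ k \<and> v $ k \<le> 1) \<longrightarrow>
        (\<forall>k. \<bar>u $ k - v $ k\<bar> \<le> 1 / 16 ^ j0) \<longrightarrow> \<bar>process n u \<omega> - process n v \<omega>\<bar> \<le> \<epsilon>)"
    proof (intro bexI[of _ ?B] conjI ballI allI impI)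
      have "prob ?B \<le> (\<Sum>j=j0..J. prob (bad_level n j))"
        by (intro measure_UNION_le) auto
      also have "\<dots> \<le> (\<Sum>j=j0..J. C / 2 ^ j)"
      proof (intro sum_mono)
        fix j assume "j \<in> {j0..J}"
        then have "(16::nat) ^ j \<le> 16 ^ J" by simp
        then have "16 ^ j \<le> n" using J(1) by linarith
        from prob_bad_level[OF this] C(2)[of j] show "prob (bad_level n j) \<le> C / 2 ^ j" by linarith
      qed
      also have "\<dots> = C * (\<Sum>j=j0..J. 1 / 2 ^ j)" by (simp add: sum_distrib_left)
      also have "\<dots> \<le> C * (2 / 2 ^ j0)" using C(1) by (intro mult_left_mono sum_inverse_powers_two_le) auto
      finally show "prob ?B < \<eta>" using j0(1) by (simp add: mult.commute)
      fix \<omega> and u v :: "real^'p"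
      assume "\<omega> \<in> space M - ?B" "\<forall>k. 0 \<le> u $ k \<and> u $ k \<le> 1" "\<forall>k. 0 \<le> v $ k \<and> v $ k \<le> 1"
        "\<forall>k. \<bar>u $ k - v $ k\<bar> \<le> 1 / 16 ^ j0"
      then have "\<bar>process n u \<omega> - process n v \<omega>\<bar> \<le> 5 / 2 ^ j0 + 2 * (sqrt (real n) * (real CARD('p) / 16 ^ J))"
        by (intro process_modulus_off_bad_levels jJ) auto
      then show "\<bar>process n u \<omega> - process n v \<omega>\<bar> \<le> \<epsilon>" using small j0(2) by simp
    qed auto
  qed auto
qed

end

section \<open>Conditional margins\<close>

text \<open>The count is a step function of \<open>t\<close> that increases only at values of
  \<open>a\<close>, so the smallest such value at which it reaches \<open>c\<close> is the exact
  threshold. Repeated values are allowed.\<close>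

lemma counting_quantile:
  fixes a :: "'i \<Rightarrow> real" and c :: real
  assumes "finite I" "0 < c" "c \<le> real (card I)"
  shows "\<exists>v\<in>a ` I. \<forall>t. c \<le> real (card {i\<in>I. a i \<le> t}) \<longleftrightarrow> v \<le> t"
proof -
  define cnt where "cnt t = real (card {i\<in>I. a i \<le> t})" for t
  have mono: "cnt s \<le> cnt t" if "s \<le> t" for s t
    unfolding cnt_def of_nat_le_iff using assms(1) that by (intro card_mono) auto
  define Q where "Q = {x\<in>a ` I. c \<le> cnt x}"
  \<comment> \<open>The count at \<open>t\<close> is already attained at the largest value of
    \<open>a\<close> not above \<open>t\<close>; positivity of \<open>c\<close> ensures that there
    is one.\<close>
  have below: "\<exists>x\<in>Q. x \<le> t" if "c \<le> cnt t" for t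
  proof -
    let ?J = "{i\<in>I. a i \<le> t}"
    have "?J \<noteq> {}" using that assms(2) unfolding cnt_def by (metis card.empty not_le of_nat_0)
    then have m: "Max (a ` ?J) \<in> a ` ?J" using assms(1) by (intro Max_in) auto
    have "cnt (Max (a ` ?J)) = cnt t"
    proof -
      have "a i \<le> Max (a ` ?J)" if "i \<in> ?J" for i using that assms(1) by (intro Max_ge) auto
      then have "{i\<in>I. a i \<le> Max (a ` ?J)} = ?J" using m by auto
      then show ?thesis by (simp add: cnt_def)
    qed
    then have "Max (a ` ?J) \<in> Q" using m that by (auto simp: Q_def)
    then show ?thesis using m by auto
  qed
  have "finite Q" using assms(1) by (auto simp: Q_def)
  have "{i\<in>I. a i \<le> Max (a ` I)} = I" using assms(1) by auto
  then have "c \<le> cnt (Max (a ` I))" using assms(3) by (simp add: cnt_def)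
  then have "Q \<noteq> {}" using below by blast
  then have v: "Min Q \<in> Q" using \<open>finite Q\<close> by (rule Min_in[rotated])
  have "c \<le> cnt t \<longleftrightarrow> Min Q \<le> t" for t
  proof
    assume "c \<le> cnt t"
    then obtain x where "x \<in> Q" "x \<le> t" using below by blast
    then show "Min Q \<le> t" using \<open>finite Q\<close> by (meson Min_le order_trans)
  next
    assume "Min Q \<le> t"
    then show "c \<le> cnt t" using v mono by (force simp: Q_def)
  qed
  then show ?thesis using v unfolding cnt_def Q_def by blast
qed

lemma vupd_nth [simp]: "vupd u k t $ j = (if j = k then t else u $ j)"
  by (simp add: vupd_def)

lemma vupd_same [simp]: "vupd u k (u $ k) = u"
  by (simp add: vec_eq_iff)

lemma vupd_vupd [simp]: "vupd (vupd u k s) k t = vupd u k t"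
  by (simp add: vec_eq_iff)

locale conditional_sample = prob_space M
  for M :: "'a measure" +
  fixes X :: "nat \<Rightarrow> 'a \<Rightarrow> real^'p" and Z :: "nat \<Rightarrow> 'a \<Rightarrow> real^'q" and A :: "(real^'q) set"
  assumes XZ_indep: "indep_vars (\<lambda>_. borel) (\<lambda>i \<omega>. (X i \<omega>, Z i \<omega>)) UNIV"
    and XZ_ident: "\<And>i. distr M borel (\<lambda>\<omega>. (X i \<omega>, Z i \<omega>)) = distr M borel (\<lambda>\<omega>. (X 0 \<omega>, Z 0 \<omega>))"
    and A_borel [measurable]: "A \<in> sets borel"
    and pA_pos: "0 < pA M Z A"
    and F_cont: "\<And>k. continuous_on UNIV (condF M X Z A k)"
begin

sublocale iid_sequence M borel "\<lambda>i \<omega>. (X i \<omega>, Z i \<omega>)"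
  by unfold_locales (fact XZ_indep XZ_ident)+

abbreviation p where "p \<equiv> pA M Z A"

abbreviation F where "F \<equiv> condF M X Z A"

section \<open>Index sets and uniformity of the conditional margins\<close>

definition S :: "real^'p \<Rightarrow> ((real^'p) \<times> (real^'q)) set" where
  "S u = {(x, z). (\<forall>k. F k (x $ k) \<le> u $ k) \<and> z \<in> A}"

definition margin :: "'p \<Rightarrow> real \<Rightarrow> ((real^'p) \<times> (real^'q)) set" where
  "margin k t = {(x, z). F k (x $ k) \<le> t \<and> z \<in> A}"

lemma margin_mono: "s \<le> t \<Longrightarrow> margin k s \<subseteq> margin k t"
  by (auto simp: margin_def)

lemma X_measurable [measurable]: "X i \<in> borel_measurable M"
  using measurable_compose[OF T_measurable[of i] borel_measurable_continuous_onI[of fst]]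
  by (simp add: continuous_on_fst continuous_on_id)

lemma Z_measurable [measurable]: "Z i \<in> borel_measurable M"
  using measurable_compose[OF T_measurable[of i] borel_measurable_continuous_onI[of snd]]
  by (simp add: continuous_on_snd continuous_on_id)

lemma snd_vimage_A: "snd -` A \<in> sets (borel :: ((real^'p) \<times> (real^'q)) measure)"
  by (intro measurable_sets_borel[OF borel_measurable_continuous_onI A_borel])
     (auto intro: continuous_intros)

lemma F_fst_continuous: "continuous_on UNIV (\<lambda>y::(real^'p) \<times> (real^'q). F k (fst y $ k))"
  by (rule continuous_on_compose2[OF F_cont]) (auto intro!: continuous_intros)

lemma S_borel: "S u \<in> sets borel"
proof -
  have "S u = {y. \<forall>k. F k (fst y $ k) \<le> u $ k} \<inter> snd -` A" by (auto simp: S_def)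
  moreover have "closed {y::(real^'p) \<times> (real^'q). \<forall>k. F k (fst y $ k) \<le> u $ k}"
    by (intro closed_Collect_all closed_Collect_le F_fst_continuous continuous_intros)
  ultimately show ?thesis using snd_vimage_A by (auto intro: borel_closed)
qed

lemma margin_borel [measurable]: "margin k t \<in> sets borel"
proof -
  have "margin k t = {y. F k (fst y $ k) \<le> t} \<inter> snd -` A" by (auto simp: margin_def)
  moreover have "closed {y::(real^'p) \<times> (real^'q). F k (fst y $ k) \<le> t}"
    by (intro closed_Collect_le F_fst_continuous continuous_intros)
  ultimately show ?thesis using snd_vimage_A by (auto intro: borel_closed)
qed

text \<open>It is the distribution function of \<open>X 0 \<omega> $ k\<close> under the conditional
  probability given that \<open>Z 0\<close> lies in \<open>A\<close>. Monotonicity and limits are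
  inherited from there.\<close>

lemma F_distribution: "\<exists>D. real_distribution D \<and> cdf D = F k"
proof -
  let ?E = "{\<omega>\<in>space M. Z 0 \<omega> \<in> A}"
  let ?P = "uniform_measure M ?E"
  let ?D = "distr ?P borel (\<lambda>\<omega>. X 0 \<omega> $ k)"
  have E: "emeasure M ?E \<noteq> 0"
    using pA_pos by (simp add: pA_def emeasure_eq_measure)
  interpret P: prob_space ?P
    using E by (intro prob_space_uniform_measure) auto
  have rv: "(\<lambda>\<omega>. X 0 \<omega> $ k) \<in> measurable ?P borel"
    by (rule measurable_compose[of "X 0" _ borel "\<lambda>x. x $ k"]) auto
  have "real_distribution ?D" using rv by (rule P.real_distribution_distr)
  moreover have "cdf ?D t = F k t" for t
  proof -
    have "cdf ?D t = measure ?P {\<omega>\<in>space M. X 0 \<omega> $ k \<le> t}"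
      unfolding cdf_def using rv by (subst measure_distr) (auto simp: vimage_def Int_def conj_commute)
    also have "\<dots> = prob (?E \<inter> {\<omega>\<in>space M. X 0 \<omega> $ k \<le> t}) / prob ?E"
      using E by (intro measure_uniform_measure) auto
    also have "?E \<inter> {\<omega>\<in>space M. X 0 \<omega> $ k \<le> t} = {\<omega>\<in>space M. X 0 \<omega> $ k \<le> t \<and> Z 0 \<omega> \<in> A}" by auto
    finally show ?thesis by (simp add: condF_def pA_def)
  qed
  ultimately show ?thesis by blast
qed

lemma F_le_1: "F k t \<le> 1" and F_mono: "s \<le> t \<Longrightarrow> F k s \<le> F k t"
  and F_at_top: "(F k \<longlongrightarrow> 1) at_top" and F_at_bot: "(F k \<longlongrightarrow> 0) at_bot"
proof -
  obtain D where D: "real_distribution D" "cdf D = F k" using F_distribution by blast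
  then interpret D: real_distribution D by simp
  note [simp] = D(2)[symmetric]
  show "F k t \<le> 1" by (simp add: D.cdf_bounded_prob)
  show "F k s \<le> F k t" if "s \<le> t" using that by (simp add: D.cdf_nondecreasing)
  show "(F k \<longlongrightarrow> 1) at_top" "(F k \<longlongrightarrow> 0) at_bot"
    by (simp_all add: D.cdf_lim_at_top_prob D.cdf_lim_at_bot)
qed

text \<open>The probability integral transform for a margin that may have flat pieces. By continuity
  the level \<open>t\<close> is attained, and \<open>Sup L\<close> is the right end of the interval
  on which it is, so \<open>F k y \<le> t\<close> means \<open>y \<le> Sup L\<close>.\<close>

lemma hit_margin_interior:
  assumes t: "0 < t" "t < 1"
  shows "hit (margin k t) = p * t"
proof -
  obtain x1 where x1: "t < F k x1"
    using order_tendstoD(1)[OF F_at_top t(2)] by (auto simp: eventually_at_top_linorder)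
  obtain x0 where x0: "F k x0 < t"
    using order_tendstoD(2)[OF F_at_bot t(1)] by (auto simp: eventually_at_bot_linorder)
  have x01: "x0 \<le> x1" using F_mono[of x1 x0 k] x0 x1 by linarith
  obtain x where x: "F k x = t"
    using IVT'[of "F k" x0 t x1] x0 x1 x01 continuous_on_subset[OF F_cont[of k], of "{x0..x1}"] by auto
  define L where "L = {x. F k x \<le> t}"
  have bdd: "bdd_above L"
  proof (rule bdd_aboveI[of _ x1])
    fix y assume "y \<in> L"
    then show "y \<le> x1" using F_mono[of x1 y k] x1 by (cases "y \<le> x1") (auto simp: L_def)
  qed
  have "closed L" unfolding L_def by (intro closed_Collect_le F_cont continuous_intros)
  moreover have xL: "x \<in> L" using x by (simp add: L_def)
  ultimately have "Sup L \<in> L" using bdd by (intro closed_contains_Sup) auto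
  moreover have "t \<le> F k (Sup L)" using F_mono[OF cSup_upper[OF xL bdd], of k] x by simp
  ultimately have FS: "F k (Sup L) = t" by (simp add: L_def)
  have iff: "F k y \<le> t \<longleftrightarrow> y \<le> Sup L" for y
    using F_mono[of y "Sup L" k] FS cSup_upper[of y L] bdd by (auto simp: L_def)
  have "hit (margin k t) = prob {\<omega>\<in>space M. X 0 \<omega> $ k \<le> Sup L \<and> Z 0 \<omega> \<in> A}"
    unfolding hit_def margin_def by (simp add: iff)
  also have "\<dots> = p * F k (Sup L)" using pA_pos by (simp add: condF_def)
  finally show ?thesis using FS by simp
qed

lemma hit_margin_ge_1: "1 \<le> t \<Longrightarrow> hit (margin k t) = p"
  unfolding hit_def margin_def pA_def
  by (rule arg_cong[where f=prob]) (auto intro: order_trans[OF F_le_1])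

text \<open>Such a level need not be attained by \<open>F k\<close>, so the previous argument fails;
  comparison with arbitrarily small positive levels replaces it.\<close>

lemma hit_margin_le_0:
  assumes "t \<le> 0"
  shows "hit (margin k t) = 0"
proof -
  have "hit (margin k t) \<le> 0 + e" if "0 < e" for e
  proof -
    define s where "s = min (1/2) (e / p)"
    have s: "0 < s" "s < 1" using that pA_pos by (auto simp: s_def)
    have "hit (margin k t) \<le> hit (margin k s)"
      using assms s by (intro hit_mono margin_mono) auto
    also have "\<dots> = p * s" by (rule hit_margin_interior[OF s])
    also have "\<dots> \<le> p * (e / p)" using pA_pos by (intro mult_left_mono) (auto simp: s_def)
    finally show ?thesis using pA_pos by simp
  qed
  then have "hit (margin k t) \<le> 0" by (rule field_le_epsilon)
  then show ?thesis by (simp add: hit_def measure_le_0_iff)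
qed

lemma hit_margin: "hit (margin k t) = p * min 1 (max 0 t)"
  using hit_margin_interior[of t k] hit_margin_ge_1[of t k] hit_margin_le_0[of t k]
  by (cases "t \<le> 0"; cases "1 \<le> t") (auto simp: max_def min_def)

lemma hit_strip: "hit (margin k t - margin k s) \<le> p * \<bar>t - s\<bar>"
proof (cases "s \<le> t")
  case True
  then have "hit (margin k t - margin k s) = p * (min 1 (max 0 t) - min 1 (max 0 s))"
    by (subst hit_diff) (auto simp: margin_mono hit_margin right_diff_distrib)
  also have "\<dots> \<le> p * \<bar>t - s\<bar>" using pA_pos by (intro mult_left_mono) auto
  finally show ?thesis .
next
  case False
  then have e: "margin k t - margin k s = {}" using margin_mono[of t s k] by auto
  show ?thesis unfolding e using pA_pos by (simp add: hit_def)
qed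

lemma p_le_1: "p \<le> 1"
  by (simp add: pA_def)

lemma S_diff_subset: "S u - S v \<subseteq> (\<Union>k. margin k (u $ k) - margin k (v $ k))"
  by (auto simp: S_def margin_def)

sublocale lipschitz_indexed_sets M borel "\<lambda>i \<omega>. (X i \<omega>, Z i \<omega>)" S
proof
  fix u v :: "real^'p"
  show "S u \<in> sets borel" by (rule S_borel)
  show "S u \<subseteq> S v" if "\<forall>k. u $ k \<le> v $ k"
    using that by (auto simp: S_def intro: order_trans)
  have "hit (S u - S v) \<le> prob (\<Union>k. {\<omega>\<in>space M. (X 0 \<omega>, Z 0 \<omega>) \<in> margin k (u $ k) - margin k (v $ k)})"
    unfolding hit_def using S_diff_subset[of u v] by (intro finite_measure_mono) auto
  also have "\<dots> \<le> (\<Sum>k\<in>UNIV. hit (margin k (u $ k) - margin k (v $ k)))"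
    unfolding hit_def by (intro measure_UNION_le) auto
  also have "\<dots> \<le> (\<Sum>k\<in>UNIV. \<bar>u $ k - v $ k\<bar>)"
  proof (rule sum_mono)
    fix k
    have "hit (margin k (u $ k) - margin k (v $ k)) \<le> p * \<bar>u $ k - v $ k\<bar>" by (rule hit_strip)
    also have "\<dots> \<le> 1 * \<bar>u $ k - v $ k\<bar>" using p_le_1 by (intro mult_right_mono) auto
    finally show "hit (margin k (u $ k) - margin k (v $ k)) \<le> \<bar>u $ k - v $ k\<bar>" by simp
  qed
  finally show "hit (S u - S v) \<le> (\<Sum>k\<in>UNIV. \<bar>u $ k - v $ k\<bar>)" .
qed

section \<open>The function \<open>D\<close>, its partial derivatives and its vanishing
  faces\<close>

abbreviation D :: "real^'p \<Rightarrow> real" where "D \<equiv> DA M X Z A"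

lemma D_eq_hit: "D u = hit (S u)"
  by (simp add: DA_def hit_def S_def UA_def)

lemma Dn_eq: "Dn M X Z A n u \<omega> = real (card {i\<in>{..<n}. (X i \<omega>, Z i \<omega>) \<in> S u}) / real n"
  by (simp add: Dn_def S_def UA_def)

lemma DDn_eq_process: "DDn M X Z A n u \<omega> = process n u \<omega>"
  by (simp add: DDn_def emp_def D_eq_hit Dn_eq)

text \<open>A change of one coordinate involves a single strip. The constant \<open>p\<close>
  matters, since it later cancels the factor \<open>1 / p\<close> of the linearization.\<close>

lemma D_lipschitz_coordinate: "\<bar>D (vupd w k s) - D (vupd w k t)\<bar> \<le> p * \<bar>s - t\<bar>"
proof -
  have "D (vupd w k s) - D (vupd w k t) \<le> p * \<bar>s - t\<bar>" for s t
  proof -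
    have "S (vupd w k s) - S (vupd w k t) \<subseteq> margin k s - margin k t"
      by (auto simp: S_def margin_def split: if_splits)
    then have "hit (S (vupd w k s) - S (vupd w k t)) \<le> hit (margin k s - margin k t)"
      using S_borel by (intro hit_mono) auto
    then show ?thesis
      using hit_diff_le[OF S_borel S_borel, of "vupd w k s" "vupd w k t"] hit_strip[of k s t]
      by (simp add: D_eq_hit)
  qed
  from this[of s t] this[of t s] show ?thesis by (simp add: abs_le_iff abs_minus_commute)
qed

lemma S_one_margin: "S (vupd (1) k t) = margin k t"
  by (auto simp: S_def margin_def F_le_1)

lemma D_one_margin: "0 \<le> t \<Longrightarrow> t \<le> 1 \<Longrightarrow> D (vupd (1) k t) = p * t"
  by (simp add: D_eq_hit S_one_margin hit_margin)

lemma D_one: "D (1) = p"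
  using D_one_margin[of 1 "undefined :: 'p"] vupd_same[of 1 "undefined :: 'p"] by simp

lemma D_zero:
  assumes "u $ k \<le> 0"
  shows "D u = 0"
proof -
  have "hit (S u) \<le> hit (margin k (u $ k))"
    by (intro hit_mono S_borel margin_borel) (auto simp: S_def margin_def)
  then show ?thesis using hit_margin_le_0[OF assms, of k] by (simp add: D_eq_hit hit_def measure_le_0_iff)
qed

text \<open>On \<open>Vk k\<close> the condition makes \<open>deriv\<close> a genuine derivative,
  and the Lipschitz constant bounds all difference quotients and so their limit.\<close>

lemma dD_bound:
  assumes C: "condC M X Z A" and u: "u \<in> Vk k"
  shows "((\<lambda>t. D (vupd u k t)) has_real_derivative dD M X Z A k u) (at (u $ k))"
    and "\<bar>dD M X Z A k u\<bar> \<le> p"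
proof -
  have "(\<lambda>t. D (vupd u k t)) differentiable (at (u $ k))"
    using C u unfolding condC_def by blast
  then show d: "((\<lambda>t. D (vupd u k t)) has_real_derivative dD M X Z A k u) (at (u $ k))"
    unfolding dD_def by (auto simp: real_differentiable_def DERIV_imp_deriv)
  then have lim: "((\<lambda>y. \<bar>(D (vupd u k y) - D (vupd u k (u $ k))) / (y - u $ k)\<bar>) \<longlongrightarrow> \<bar>dD M X Z A k u\<bar>) (at (u $ k))"
    by (intro tendsto_rabs) (simp add: has_field_derivative_iff)
  show "\<bar>dD M X Z A k u\<bar> \<le> p"
  proof (rule tendsto_upperbound[OF lim])
    show "\<forall>\<^sub>F y in at (u $ k). \<bar>(D (vupd u k y) - D (vupd u k (u $ k))) / (y - u $ k)\<bar> \<le> p"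
      using D_lipschitz_coordinate[of u k _ "u $ k"]
      by (auto simp: eventually_at_filter abs_divide divide_le_eq simp del: vupd_same)
  qed simp
qed

text \<open>Off this event every observation with \<open>Z i \<omega>\<close> in \<open>A\<close>
  has positive transforms, for all sample sizes at once. Hence the process vanishes on the lower
  faces and empirical quantiles are positive.\<close>

definition null_event :: "'a set" where
  "null_event = (\<Union>i. \<Union>k. {\<omega>\<in>space M. (X i \<omega>, Z i \<omega>) \<in> margin k 0})"

lemma null_event_sets [measurable]: "null_event \<in> sets M"
  unfolding null_event_def by (intro sets.countable_UN' countableI_type) auto

lemma prob_null_event: "prob null_event = 0"
proof -
  have "{\<omega>\<in>space M. (X i \<omega>, Z i \<omega>) \<in> margin k 0} \<in> null_sets M" for i k
    using prob_T[OF margin_borel, of i k 0] hit_margin_le_0[of 0 k]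
    by (auto simp: null_sets_def emeasure_eq_measure)
  then have "null_event \<in> null_sets M"
    unfolding null_event_def by (intro null_sets_UN' countableI_type)
  then show ?thesis by (simp add: null_sets_def emeasure_eq_measure)
qed

lemma process_zero:
  assumes "\<omega> \<in> space M" "\<omega> \<notin> null_event" "u $ k \<le> 0"
  shows "process n u \<omega> = 0"
proof -
  have "(X i \<omega>, Z i \<omega>) \<notin> S u" for i
  proof
    assume "(X i \<omega>, Z i \<omega>) \<in> S u"
    then have "(X i \<omega>, Z i \<omega>) \<in> margin k 0"
      using order_trans[OF _ assms(3)] by (simp add: S_def margin_def)
    then show False using assms(1,2) by (auto simp: null_event_def)
  qed
  then have "{i\<in>{..<n}. (X i \<omega>, Z i \<omega>) \<in> S u} = {}" by blast
  then show ?thesis using D_zero[OF assms(3)] by (simp add: emp_def D_eq_hit)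
qed

end

section \<open>Empirical quantiles and coordinate increments\<close>

lemma unitcube_iff: "u \<in> unitcube \<longleftrightarrow> (\<forall>k. 0 \<le> u $ k \<and> u $ k \<le> 1)"
  by (simp add: unitcube_def)

lemma compact_unitcube_slab:
  "compact {x::real^'p. x \<in> unitcube \<and> a \<le> x $ k \<and> x $ k \<le> b}"
proof -
  have "{x::real^'p. x \<in> unitcube \<and> a \<le> x $ k \<and> x $ k \<le> b} = cbox 0 1 \<inter> {x. a \<le> x $ k} \<inter> {x. x $ k \<le> b}"
    by (auto simp: unitcube_iff mem_box_cart)
  moreover have "closed {x::real^'p. a \<le> x $ k}" "closed {x::real^'p. x $ k \<le> b}"
    by (intro closed_Collect_le continuous_intros)+
  ultimately show ?thesis by (simp add: compact_Int_closed)
qed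

context conditional_sample
begin

abbreviation margin_process :: "nat \<Rightarrow> 'p \<Rightarrow> real \<Rightarrow> 'a \<Rightarrow> real" where
  "margin_process n k t \<omega> \<equiv> process n (vupd 1 k t) \<omega>"

text \<open>A property of a single outcome, so that the estimates built on it are
  deterministic.\<close>

definition modulus_bound :: "nat \<Rightarrow> 'a \<Rightarrow> real \<Rightarrow> real \<Rightarrow> bool" where
  "modulus_bound n \<omega> \<delta> \<epsilon> \<longleftrightarrow> (\<forall>u\<in>unitcube. \<forall>v\<in>unitcube. (\<forall>k. \<bar>u $ k - v $ k\<bar> \<le> \<delta>) \<longrightarrow>
     \<bar>process n u \<omega> - process n v \<omega>\<bar> \<le> \<epsilon>)"

text \<open>The process is zero at the origin, which is joined to \<open>u\<close> by \<open>m\<close> steps of size at most \<open>\<delta>\<close>.\<close>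

lemma process_bounded:
  assumes om: "\<omega> \<in> space M" "\<omega> \<notin> null_event"
    and m: "modulus_bound n \<omega> \<delta> 1" "0 < m" "1 / real m \<le> \<delta>" and u: "u \<in> unitcube"
  shows "\<bar>process n u \<omega>\<bar> \<le> real m"
proof -
  define w where "w i = (real i / real m) *\<^sub>R u" for i
  have wi: "w i \<in> unitcube" if "i \<le> m" for i
  proof -
    have "real i * u $ k \<le> real m * 1" for k
      using that u by (intro mult_mono) (auto simp: unitcube_iff)
    then show ?thesis using u m(2) by (auto simp: w_def unitcube_iff)
  qed
  have "\<bar>process n (w i) \<omega>\<bar> \<le> real i" if "i \<le> m" for i
    using that
  proof (induction i)
    case 0
    have "process n (w 0) \<omega> = 0" by (rule process_zero[OF om, of _ undefined]) (simp add: w_def)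
    then show ?case by simp
  next
    case (Suc i)
    have "\<bar>w (Suc i) $ k - w i $ k\<bar> \<le> \<delta>" for k
    proof -
      have "w (Suc i) $ k - w i $ k = 1 / real m * u $ k"
        by (simp add: w_def add_divide_distrib distrib_right)
      moreover have "0 \<le> u $ k" "u $ k \<le> 1" using u by (auto simp: unitcube_iff)
      ultimately have "\<bar>w (Suc i) $ k - w i $ k\<bar> \<le> 1 / real m * 1"
        by (simp add: divide_right_mono)
      then show ?thesis using m(3) by simp
    qed
    then have "\<bar>process n (w (Suc i)) \<omega> - process n (w i) \<omega>\<bar> \<le> 1"
      using m(1) wi[of i] wi[of "Suc i"] Suc.prems by (auto simp: modulus_bound_def)
    with Suc show ?case by simp
  qed
  from this[of m] m(2) show ?thesis by (simp add: w_def)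
qed

lemma vupd_one_unitcube: "0 \<le> t \<Longrightarrow> t \<le> 1 \<Longrightarrow> vupd 1 k t \<in> unitcube"
  by (simp add: unitcube_iff)

lemma one_unitcube: "1 \<in> unitcube"
  by (simp add: unitcube_iff)

section \<open>Inversion of the empirical margins\<close>

lemma margin_process_eq:
  assumes "0 \<le> t" "t \<le> 1"
  shows "margin_process n k t \<omega> =
    sqrt (real n) * (real (card {i\<in>{i\<in>{..<n}. Z i \<omega> \<in> A}. F k (X i \<omega> $ k) \<le> t}) / real n - p * t)"
proof -
  have "{i\<in>{..<n}. (X i \<omega>, Z i \<omega>) \<in> margin k t} = {i\<in>{i\<in>{..<n}. Z i \<omega> \<in> A}. F k (X i \<omega> $ k) \<le> t}"
    by (auto simp: margin_def)
  then show ?thesis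
    using assms by (simp add: emp_def S_one_margin hit_margin)
qed

lemma process_one_eq: "process n 1 \<omega> = sqrt (real n) * (real (nA Z A n \<omega>) / real n - p)"
proof -
  have "{i\<in>{..<n}. (X i \<omega>, Z i \<omega>) \<in> S 1} = {i\<in>{..<n}. Z i \<omega> \<in> A}"
    by (auto simp: S_def F_le_1)
  then show ?thesis using D_one by (simp add: emp_def nA_def D_eq_hit)
qed

text \<open>The count reaches \<open>u * nA\<close> at \<open>v\<close> and not before; rescaling
  turns this into two inequalities for the process. The upper one holds only strictly below
  \<open>v\<close>, because the count may jump at \<open>v\<close>.\<close>

lemma Gninv_quantile:
  assumes om: "\<omega> \<in> space M" "\<omega> \<notin> null_event" and n: "0 < n" "0 < nA Z A n \<omega>" and u: "0 < u" "u \<le> 1"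
  shows "\<exists>v. 0 < v \<and> v \<le> 1 \<and> Gninv M X Z A n k \<omega> u = ereal v \<and>
    u * process n 1 \<omega> \<le> margin_process n k v \<omega> + sqrt (real n) * p * (v - u) \<and>
    (\<forall>s. 0 \<le> s \<and> s < v \<longrightarrow> margin_process n k s \<omega> + sqrt (real n) * p * (s - u) \<le> u * process n 1 \<omega>)"
proof -
  define I where "I = {i\<in>{..<n}. Z i \<omega> \<in> A}"
  define a where "a i = F k (X i \<omega> $ k)" for i
  define c where "c = u * real (nA Z A n \<omega>)"
  have cI: "card I = nA Z A n \<omega>" by (simp add: I_def nA_def)
  have c: "0 < c" "c \<le> real (card I)" using n u by (auto simp: c_def cI mult_left_le_one_le)
  obtain v where v: "v \<in> a ` I" "\<And>t. c \<le> real (card {i\<in>I. a i \<le> t}) \<longleftrightarrow> v \<le> t"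
    using counting_quantile[of I c a] c by (auto simp: I_def)
  obtain i where i: "i \<in> I" "v = a i" using v(1) by blast
  have v1: "v \<le> 1" using i F_le_1 by (simp add: a_def)
  have v0: "0 < v"
  proof (rule ccontr)
    assume "\<not> 0 < v"
    then have "(X i \<omega>, Z i \<omega>) \<in> margin k 0" using i by (simp add: margin_def a_def I_def)
    then show False using om by (auto simp: null_event_def)
  qed
  have G: "Gn M X Z A n k \<omega> t = real (card {i\<in>I. a i \<le> t}) / real (nA Z A n \<omega>)" for t
  proof -
    have "{i\<in>{..<n}. UA M X Z A i \<omega> $ k \<le> t \<and> Z i \<omega> \<in> A} = {i\<in>I. a i \<le> t}"
      by (auto simp: UA_def a_def I_def)
    then show ?thesis using n by (simp add: Gn_def)
  qed
  have "u \<le> Gn M X Z A n k \<omega> t \<longleftrightarrow> v \<le> t" for t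
    unfolding G v(2)[symmetric] c_def using n by (simp add: le_divide_eq)
  then have "{t. u \<le> Gn M X Z A n k \<omega> t} = {v..}" by auto
  then have "Gninv M X Z A n k \<omega> u = Inf (ereal ` {v..})" by (simp add: Gninv_def)
  also have "\<dots> = ereal v" by (intro Inf_eqI) auto
  finally have inv: "Gninv M X Z A n k \<omega> u = ereal v" .
  \<comment> \<open>The centring terms \<open>p * t\<close> and \<open>u * p\<close> cancel against
    the drift, leaving the count minus its target \<open>c\<close>.\<close>
  have mp: "margin_process n k t \<omega> + sqrt (real n) * p * (t - u) - u * process n 1 \<omega> =
      sqrt (real n) / real n * (real (card {i\<in>I. a i \<le> t}) - c)" if "0 \<le> t" "t \<le> 1" for t
    using that n unfolding margin_process_eq[OF that] process_one_eq c_def I_def a_def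
    by (simp add: field_simps)
  have "0 \<le> sqrt (real n) / real n * (real (card {i\<in>I. a i \<le> v}) - c)"
    using v(2)[of v] by (intro mult_nonneg_nonneg) auto
  then have 1: "u * process n 1 \<omega> \<le> margin_process n k v \<omega> + sqrt (real n) * p * (v - u)"
    using mp[of v] v0 v1 by simp
  have 2: "margin_process n k s \<omega> + sqrt (real n) * p * (s - u) \<le> u * process n 1 \<omega>"
    if "0 \<le> s" "s < v" for s
  proof -
    have "sqrt (real n) / real n * (real (card {i\<in>I. a i \<le> s}) - c) \<le> 0"
      using v(2)[of s] that by (intro mult_nonneg_nonpos) auto
    then show ?thesis using mp[of s] that v1 by simp
  qed
  show ?thesis using v0 v1 inv 1 2 by blast
qed

text \<open>A bootstrap in two steps: the crude bound \<open>K\<close> first places \<open>v\<close>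
  within \<open>\<delta>\<close> of \<open>u\<close>, and only then may the modulus replace the
  process near \<open>v\<close> by its value at \<open>u\<close>.\<close>

lemma quantile_linearization:
  assumes om: "\<omega> \<in> space M" "\<omega> \<notin> null_event" and n: "0 < n" "0 < nA Z A n \<omega>" and u: "0 < u" "u \<le> 1"
    and md: "modulus_bound n \<omega> \<delta> \<epsilon>"
    and K: "\<And>w. w \<in> unitcube \<Longrightarrow> \<bar>process n w \<omega>\<bar> \<le> K"
    and small: "2 * K / p / sqrt (real n) < \<delta>"
  shows "\<exists>v. 0 < v \<and> v \<le> 1 \<and> Gninv M X Z A n k \<omega> u = ereal v \<and>
    sqrt (real n) * \<bar>v - u\<bar> \<le> 2 * K / p \<and>
    \<bar>p * (sqrt (real n) * (v - u)) + (margin_process n k u \<omega> - u * process n 1 \<omega>)\<bar> \<le> \<epsilon>"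
proof -
  define r where "r = sqrt (real n) * p"
  have r: "0 < r" using n pA_pos by (simp add: r_def)
  obtain v where v: "0 < v" "v \<le> 1" "Gninv M X Z A n k \<omega> u = ereal v"
    and lo: "u * process n 1 \<omega> \<le> margin_process n k v \<omega> + r * (v - u)"
    and up: "\<And>s. 0 \<le> s \<Longrightarrow> s < v \<Longrightarrow> margin_process n k s \<omega> + r * (s - u) \<le> u * process n 1 \<omega>"
    using Gninv_quantile[OF om n u, of k] unfolding r_def by blast
  \<comment> \<open>Once the process is bounded by a constant, the linear drift passes to the limit
    from below \<open>v\<close>, so the size of the jump at \<open>v\<close> never enters.\<close>
  have up_lim: "r * (v - u) \<le> R"
    if "x < v" "0 \<le> x" "\<And>s. x < s \<Longrightarrow> s < v \<Longrightarrow> r * (s - u) \<le> R" for R x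
  proof -
    have "v \<le> R / r + u"
    proof (rule dense_le_bounded[OF that(1)])
      fix s assume "x < s" "s < v"
      from that(3)[OF this] show "s \<le> R / r + u" using r by (simp add: field_simps)
    qed
    then show ?thesis using r by (simp add: field_simps)
  qed
  have Km: "\<bar>margin_process n k t \<omega>\<bar> \<le> K" if "0 \<le> t" "t \<le> 1" for t
    using K vupd_one_unitcube that by blast
  have K1: "\<bar>u * process n 1 \<omega>\<bar> \<le> K"
  proof -
    have "\<bar>u * process n 1 \<omega>\<bar> = u * \<bar>process n 1 \<omega>\<bar>" using u by (simp add: abs_mult)
    also have "\<dots> \<le> 1 * K" using u K[OF one_unitcube] by (intro mult_mono) auto
    finally show ?thesis by simp
  qed
  have "r * (v - u) \<le> 2 * K"
  proof (rule up_lim[of 0])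
    fix s assume "0 < s" "s < v"
    then show "r * (s - u) \<le> 2 * K" using up[of s] Km[of s] K1 v(2) by linarith
  qed (use v in auto)
  moreover have "- (2 * K) \<le> r * (v - u)" using lo Km[of v] K1 v by linarith
  ultimately have "r * \<bar>v - u\<bar> \<le> 2 * K" using r by (simp add: abs_if algebra_simps)
  then have vu: "sqrt (real n) * \<bar>v - u\<bar> \<le> 2 * K / p"
    using pA_pos by (simp add: r_def field_simps)
  then have "\<bar>v - u\<bar> \<le> 2 * K / p / sqrt (real n)"
    using n by (simp only: pos_le_divide_eq real_sqrt_gt_0_iff of_nat_0_less_iff mult.commute)
  then have close: "\<bar>v - u\<bar> < \<delta>" using small by simp
  have md': "\<bar>margin_process n k s \<omega> - margin_process n k u \<omega>\<bar> \<le> \<epsilon>" if "0 \<le> s" "s \<le> 1" "\<bar>s - u\<bar> \<le> \<delta>" for s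
  proof -
    have "0 \<le> \<delta>" using that(3) by linarith
    then show ?thesis
      using that u by (intro md[unfolded modulus_bound_def, rule_format] vupd_one_unitcube) auto
  qed
  have "r * (v - u) \<le> u * process n 1 \<omega> - margin_process n k u \<omega> + \<epsilon>"
  \<comment> \<open>This starting point keeps \<open>s\<close> nonnegative and within
    \<open>\<delta>\<close> of \<open>u\<close>, as the modulus requires.\<close>
  proof (rule up_lim[of "max 0 (u - \<delta>)"])
    show "max 0 (u - \<delta>) < v" using close v by auto
    fix s assume s: "max 0 (u - \<delta>) < s" "s < v"
    then have "0 \<le> s" "s \<le> 1" "\<bar>s - u\<bar> \<le> \<delta>" using close v by auto
    with up[of s] md'[of s] s show "r * (s - u) \<le> u * process n 1 \<omega> - margin_process n k u \<omega> + \<epsilon>"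
      by linarith
  qed simp
  moreover have "u * process n 1 \<omega> - margin_process n k u \<omega> - \<epsilon> \<le> r * (v - u)"
    using lo md'[of v] v close by linarith
  moreover have "p * (sqrt (real n) * (v - u)) = r * (v - u)" by (simp add: r_def)
  ultimately have "\<bar>p * (sqrt (real n) * (v - u)) + (margin_process n k u \<omega> - u * process n 1 \<omega>)\<bar> \<le> \<epsilon>"
    by linarith
  then show ?thesis using v vu by blast
qed

section \<open>Expansion of \<open>D\<close> in one coordinate\<close>

lemma D_mean_value:
  assumes C: "condC M X Z A" and w: "w \<in> unitcube" and st: "0 < s" "s < 1" "0 < t" "t < 1"
  shows "\<exists>\<xi>. min s t \<le> \<xi> \<and> \<xi> \<le> max s t \<and>
    D (vupd w k t) - D (vupd w k s) = (t - s) * dD M X Z A k (vupd w k \<xi>)"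
proof -
  have der: "((\<lambda>t. D (vupd w k t)) has_real_derivative dD M X Z A k (vupd w k \<xi>)) (at \<xi>)"
    if "0 < \<xi>" "\<xi> < 1" for \<xi>
  proof -
    \<comment> \<open>\<open>Vk\<close> keeps only coordinate \<open>k\<close> off the boundary; the
      others may be zero or one.\<close>
    have "vupd w k \<xi> \<in> Vk k" using w that by (auto simp: Vk_def unitcube_iff)
    from dD_bound(1)[OF C this] show ?thesis by simp
  qed
  consider "s < t" | "s = t" | "t < s" by linarith
  then show ?thesis
  proof cases
    case 1
    with MVT2[of s t "\<lambda>t. D (vupd w k t)" "\<lambda>\<xi>. dD M X Z A k (vupd w k \<xi>)"] der st
    obtain \<xi> where "s < \<xi>" "\<xi> < t" "D (vupd w k t) - D (vupd w k s) = (t - s) * dD M X Z A k (vupd w k \<xi>)"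
      by force
    then show ?thesis by (intro exI[of _ \<xi>]) auto
  next
    case 3
    with MVT2[of t s "\<lambda>t. D (vupd w k t)" "\<lambda>\<xi>. dD M X Z A k (vupd w k \<xi>)"] der st
    obtain \<xi> where "t < \<xi>" "\<xi> < s" "D (vupd w k s) - D (vupd w k t) = (s - t) * dD M X Z A k (vupd w k \<xi>)"
      by force
    then show ?thesis by (intro exI[of _ \<xi>]) (auto simp: algebra_simps)
  qed auto
qed

definition dD_modulus :: "real \<Rightarrow> real \<Rightarrow> real \<Rightarrow> bool" where
  "dD_modulus \<delta> d \<epsilon> \<longleftrightarrow> (\<forall>k. \<forall>x\<in>unitcube. \<forall>y\<in>unitcube.
     \<delta> \<le> x $ k \<and> x $ k \<le> 1 - \<delta> \<and> \<delta> \<le> y $ k \<and> y $ k \<le> 1 - \<delta> \<and> (\<forall>j. \<bar>x $ j - y $ j\<bar> \<le> d) \<longrightarrow>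
     \<bar>dD M X Z A k x - dD M X Z A k y\<bar> \<le> \<epsilon>)"

text \<open>The slab at distance \<open>\<delta>\<close> from the two faces is a compact subset of
  \<open>Vk k\<close>, so continuity there is uniform. The minimum over the finitely many directions
  gives one \<open>d\<close> for all.\<close>

lemma dD_modulus_exists:
  assumes C: "condC M X Z A" and "0 < \<delta>" "0 < \<epsilon>"
  shows "\<exists>d>0. dD_modulus \<delta> d \<epsilon>"
proof -
  have "\<exists>d>0. \<forall>x\<in>unitcube. \<forall>y\<in>unitcube.
     \<delta> \<le> x $ k \<and> x $ k \<le> 1 - \<delta> \<and> \<delta> \<le> y $ k \<and> y $ k \<le> 1 - \<delta> \<and> (\<forall>j. \<bar>x $ j - y $ j\<bar> \<le> d) \<longrightarrow>
     \<bar>dD M X Z A k x - dD M X Z A k y\<bar> \<le> \<epsilon>" for k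
  proof -
    let ?S = "{x::real^'p. x \<in> unitcube \<and> \<delta> \<le> x $ k \<and> x $ k \<le> 1 - \<delta>}"
    have "?S \<subseteq> Vk k" using assms(2) by (auto simp: Vk_def)
    moreover have "continuous_on (Vk k) (dD M X Z A k)" using C unfolding condC_def by blast
    ultimately have "uniformly_continuous_on ?S (dD M X Z A k)"
      using continuous_on_subset by (intro compact_uniformly_continuous compact_unitcube_slab) blast
    then obtain d where d: "0 < d"
      "\<And>x y. x \<in> ?S \<Longrightarrow> y \<in> ?S \<Longrightarrow> dist y x < d \<Longrightarrow> dist (dD M X Z A k y) (dD M X Z A k x) < \<epsilon>"
      unfolding uniformly_continuous_on_def using assms(3) by blast
    \<comment> \<open>Passes from the Euclidean distance to coordinatewise closeness; the factor 2
      provides strictness.\<close>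
    let ?d = "d / (2 * real CARD('p))"
    show ?thesis
    proof (intro exI[of _ ?d] conjI ballI impI)
      show "0 < ?d" using d by simp
      fix x y :: "real^'p"
      assume xy: "x \<in> unitcube" "y \<in> unitcube"
        "\<delta> \<le> x $ k \<and> x $ k \<le> 1 - \<delta> \<and> \<delta> \<le> y $ k \<and> y $ k \<le> 1 - \<delta> \<and> (\<forall>j. \<bar>x $ j - y $ j\<bar> \<le> ?d)"
      have "dist x y \<le> (\<Sum>j\<in>UNIV. \<bar>(x - y) $ j\<bar>)" unfolding dist_norm by (rule norm_le_l1_cart)
      also have "\<dots> \<le> real CARD('p) * ?d"
        using sum_bounded_above[of UNIV "\<lambda>j. \<bar>(x - y) $ j\<bar>" ?d] xy(3) by simp
      also have "\<dots> < d" using d(1) by simp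
      finally have "dist (dD M X Z A k x) (dD M X Z A k y) < \<epsilon>"
        using xy by (intro d(2)) auto
      then show "\<bar>dD M X Z A k x - dD M X Z A k y\<bar> \<le> \<epsilon>" by (simp add: dist_real_def)
    qed
  qed
  then obtain d where d: "\<And>k. 0 < d k" "\<And>k x y. x\<in>unitcube \<Longrightarrow> y\<in>unitcube \<Longrightarrow>
     \<delta> \<le> x $ k \<and> x $ k \<le> 1 - \<delta> \<and> \<delta> \<le> y $ k \<and> y $ k \<le> 1 - \<delta> \<and> (\<forall>j. \<bar>x $ j - y $ j\<bar> \<le> d k) \<Longrightarrow>
     \<bar>dD M X Z A k x - dD M X Z A k y\<bar> \<le> \<epsilon>"
    by metis
  have "Min (range d) \<le> d k" for k by simp
  then have "dD_modulus \<delta> (Min (range d)) \<epsilon>"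
    unfolding dD_modulus_def by (intro allI ballI impI d(2)) (auto intro: order_trans)
  moreover have "0 < Min (range d)" using d(1) by simp
  ultimately show ?thesis by blast
qed

text \<open>Here \<open>w\<close> is \<open>u\<close> with some other coordinates already moved, yet
  the derivative is taken at \<open>u\<close>. Near the faces the two terms are bounded separately,
  by \<open>3 * \<epsilon>\<close> and \<open>2 * \<epsilon>\<close>. Elsewhere one
  \<open>\<epsilon>\<close> pays for moving the derivative from the mean value point to
  \<open>u\<close>, and another for the linearized quantile.\<close>

lemma coordinate_increment:
  fixes r \<gamma> :: real
  assumes C: "condC M X Z A" and w: "w \<in> unitcube" and u: "u \<in> unitcube" "0 < u $ k"
    and wk: "w $ k = u $ k" and wu: "\<forall>j. \<bar>w $ j - u $ j\<bar> \<le> d"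
    and t: "0 < t" "t \<le> 1" "\<bar>t - u $ k\<bar> \<le> d" "\<bar>t - u $ k\<bar> \<le> \<delta>"
    and dm: "dD_modulus \<delta> d \<epsilon>'" and r: "0 < r" "r * \<bar>t - u $ k\<bar> \<le> L" "\<epsilon>' * L \<le> \<epsilon>" "0 \<le> \<epsilon>'"
    and lin: "\<bar>p * (r * (t - u $ k)) + \<gamma>\<bar> \<le> \<epsilon>"
    and bd: "u $ k < 2 * \<delta> \<or> 1 - 2 * \<delta> < u $ k \<Longrightarrow> \<bar>\<gamma>\<bar> \<le> 2 * \<epsilon>" and uk1: "u $ k = 1 \<Longrightarrow> \<gamma> = 0"
    and "0 < \<delta>"
  shows "\<bar>r * (D (vupd w k t) - D w) + 1 / p * (dD M X Z A k u * \<gamma>)\<bar> \<le> 5 * \<epsilon>"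
proof -
  let ?d = "dD M X Z A k u"
  have w': "vupd w k (u $ k) = w" using wk by (simp add: vec_eq_iff)
  have uk: "u $ k \<le> 1" using u by (auto simp: unitcube_iff)
  have eps: "0 \<le> \<epsilon>" using lin by linarith
  have scale: "\<bar>1 / p * (?d * y)\<bar> \<le> \<bar>y\<bar>" if "u $ k < 1" for y
  proof -
    have "u \<in> Vk k" using u that by (simp add: Vk_def)
    then have "\<bar>?d\<bar> \<le> p" by (rule dD_bound(2)[OF C])
    then have "\<bar>?d\<bar> / p * \<bar>y\<bar> \<le> 1 * \<bar>y\<bar>" using pA_pos by (intro mult_right_mono) auto
    then show ?thesis using pA_pos by (simp add: abs_mult)
  qed
  show ?thesis
  proof (cases "u $ k < 2 * \<delta> \<or> 1 - 2 * \<delta> < u $ k")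
    case True
    have g: "\<bar>\<gamma>\<bar> \<le> 2 * \<epsilon>" using bd True by blast
    have "\<bar>r * (D (vupd w k t) - D w)\<bar> = r * \<bar>D (vupd w k t) - D (vupd w k (u $ k))\<bar>"
      using r w' by (simp add: abs_mult)
    also have "\<dots> \<le> r * (p * \<bar>t - u $ k\<bar>)"
      using r by (intro mult_left_mono D_lipschitz_coordinate) auto
    also have "\<dots> = \<bar>p * (r * (t - u $ k))\<bar>" using r pA_pos by (simp add: abs_mult)
    also have "\<dots> \<le> 3 * \<epsilon>" using lin g by linarith
    finally have 1: "\<bar>r * (D (vupd w k t) - D w)\<bar> \<le> 3 * \<epsilon>" .
    \<comment> \<open>At \<open>u $ k = 1\<close> no bound on the derivative is available, but there
      \<open>\<gamma>\<close> is exactly zero.\<close>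
    have 2: "\<bar>1 / p * (?d * \<gamma>)\<bar> \<le> 2 * \<epsilon>"
    proof (cases "u $ k = 1")
      case True
      then show ?thesis using uk1 eps by simp
    next
      case False
      then show ?thesis using scale[of \<gamma>] g uk by linarith
    qed
    show ?thesis by (rule order_trans[OF abs_triangle_ineq]) (use 1 2 in linarith)
  next
    case False
    then have uk2: "2 * \<delta> \<le> u $ k" "u $ k \<le> 1 - 2 * \<delta>" by auto
    \<comment> \<open>The room between \<open>2 * \<delta>\<close> and \<open>\<delta>\<close> keeps
      \<open>t\<close>, and with it the mean value point, in the slab of
      \<open>dD_modulus\<close>.\<close>
    have t2: "\<delta> \<le> t" "t \<le> 1 - \<delta>" using uk2 t(4) by auto
    obtain \<xi> where xi: "min (u $ k) t \<le> \<xi>" "\<xi> \<le> max (u $ k) t"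
      and mv: "D (vupd w k t) - D (vupd w k (u $ k)) = (t - u $ k) * dD M X Z A k (vupd w k \<xi>)"
      using D_mean_value[OF C w, of "u $ k" t k] uk2 t2 \<open>0 < \<delta>\<close> by force
    have xb: "\<delta> \<le> \<xi>" "\<xi> \<le> 1 - \<delta>" "\<bar>\<xi> - u $ k\<bar> \<le> d" using xi uk2 t2 t(3) \<open>0 < \<delta>\<close> by auto
    have "vupd w k \<xi> \<in> unitcube" using w xb \<open>0 < \<delta>\<close> by (auto simp: unitcube_iff)
    then have "\<bar>dD M X Z A k (vupd w k \<xi>) - ?d\<bar> \<le> \<epsilon>'"
      using xb uk2 wu \<open>0 < \<delta>\<close> u by (intro dm[unfolded dD_modulus_def, rule_format]) auto
    moreover have "0 \<le> L"
      using r(1,2) by (meson abs_ge_zero less_imp_le mult_nonneg_nonneg order_trans)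
    ultimately have 1: "\<bar>r * (t - u $ k) * (dD M X Z A k (vupd w k \<xi>) - ?d)\<bar> \<le> L * \<epsilon>'"
      unfolding abs_mult using r by (intro mult_mono) (auto simp: abs_mult)
    have 2: "\<bar>1 / p * (?d * (p * (r * (t - u $ k)) + \<gamma>))\<bar> \<le> \<epsilon>"
      using scale[of "p * (r * (t - u $ k)) + \<gamma>"] lin uk2 \<open>0 < \<delta>\<close> by linarith
    have "r * (D (vupd w k t) - D w) + 1 / p * (?d * \<gamma>) =
      r * (t - u $ k) * (dD M X Z A k (vupd w k \<xi>) - ?d) + 1 / p * (?d * (p * (r * (t - u $ k)) + \<gamma>))"
      using pA_pos unfolding mv[unfolded w'] by (simp add: field_simps)
    also have "\<bar>\<dots>\<bar> \<le> L * \<epsilon>' + \<epsilon>"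
      by (rule order_trans[OF abs_triangle_ineq add_mono[OF 1 2]])
    finally have "\<bar>r * (D (vupd w k t) - D w) + 1 / p * (?d * \<gamma>)\<bar> \<le> \<epsilon> + \<epsilon>"
      using r(3) by (simp only: mult.commute[of L])
    then show ?thesis by (rule order_trans) (use eps in simp)
  qed
qed

end

section \<open>The remainder of the linearization\<close>

context conditional_sample
begin

lemma DDtilden_eq: "DDtilden M X Z A n u \<omega> = process n u \<omega> - 1 / p * (\<Sum>k\<in>UNIV. dD M X Z A k u *
    (margin_process n k (u $ k) \<omega> - u $ k * process n 1 \<omega>))"
  by (simp add: DDtilden_def DDn_eq_process)

text \<open>
  If \<open>u $ k = 0\<close>, then \<open>Gninv\<close> is \<open>-\<infinity>\<close> in coordinate \<open>k\<close>. The term of \<open>dD\<close> in direction \<open>k\<close> may be a junk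
  value of \<open>deriv\<close>, but it is multiplied by zero.
\<close>

lemma remainder_zero_coordinate:
  assumes om: "\<omega> \<in> space M" "\<omega> \<notin> null_event" and k: "u $ k = 0"
  shows "DDbarn M X Z A n u \<omega> - DDtilden M X Z A n u \<omega> = 0"
proof -
  have nn: "0 \<le> Gn M X Z A n k \<omega> t" for t by (simp add: Gn_def)
  have "Inf (range ereal) = - \<infinity>"
    by (metis INF_lower UNIV_I ereal_bot)
  then have "Gninv M X Z A n k \<omega> (u $ k) = - \<infinity>" by (simp add: Gninv_def k nn)
  then have "{i\<in>{..<n}. (\<forall>k. ereal (UA M X Z A i \<omega> $ k) \<le> Gninv M X Z A n k \<omega> (u $ k)) \<and> Z i \<omega> \<in> A} = {}"
    by (auto intro!: exI[of _ k])
  then have "Dbarn M X Z A n u \<omega> = 0" by (simp add: Dbarn_def)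
  then have "DDbarn M X Z A n u \<omega> = 0" using D_zero[of u k] k by (simp add: DDbarn_def)
  moreover have z: "dD M X Z A j u * (margin_process n j (u $ j) \<omega> - u $ j * process n 1 \<omega>) = 0" for j
  proof (cases "j = k")
    case True
    then show ?thesis using process_zero[OF om, of "vupd 1 k 0" k n] k by simp
  next
    case False
    \<comment> \<open>In the other directions \<open>D\<close> is identically zero along the whole
      line, so \<open>deriv\<close> has the true value zero even at end points.\<close>
    then have "D (vupd u j t) = 0" for t using k by (intro D_zero[of _ k]) simp
    then show ?thesis by (simp add: dD_def)
  qed
  moreover have "process n u \<omega> = 0" using process_zero[OF om, of u k n] k by simp
  ultimately show ?thesis unfolding DDtilden_eq z by simp
qed

text \<open>Each coordinate costs \<open>5 * \<epsilon>\<close>, and replacing the process at the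
  quantile vector by its value at \<open>u\<close> costs one more \<open>\<epsilon>\<close>. The
  tolerance for \<open>dD\<close> is divided by \<open>2 * K / p\<close> because it gets multiplied
  by that bound on the scaled quantile error.\<close>

lemma remainder_bound:
  assumes C: "condC M X Z A"
    and om: "\<omega> \<in> space M" "\<omega> \<notin> null_event" and n: "0 < n"
    and md: "modulus_bound n \<omega> \<delta>' \<epsilon>"
    and K: "\<And>w. w \<in> unitcube \<Longrightarrow> \<bar>process n w \<omega>\<bar> \<le> K" "0 < K"
    and dm: "dD_modulus \<delta> d (\<epsilon> / (2 * K / p))" and del: "0 < \<delta>" "2 * \<delta> \<le> \<delta>'" "2 * \<delta> * K \<le> \<epsilon>"
    and small: "2 * K / p / sqrt (real n) < min (min \<delta>' 1) (min d \<delta>)"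
    and u: "u \<in> unitcube"
  shows "\<bar>DDbarn M X Z A n u \<omega> - DDtilden M X Z A n u \<omega>\<bar> \<le> (5 * real CARD('p) + 1) * \<epsilon>"
proof -
  have eps: "0 \<le> \<epsilon>" using del K(2) by (smt (verit) mult_nonneg_nonneg)
  show ?thesis
  proof (cases "\<exists>k. u $ k = 0")
    case True
    then show ?thesis using remainder_zero_coordinate[OF om] eps by auto
  next
    case False
    then have u0: "0 < u $ k" "u $ k \<le> 1" for k using u by (auto simp: unitcube_iff less_le)
    define r where "r = sqrt (real n)"
    have r: "0 < r" using n by (simp add: r_def)
    \<comment> \<open>With no observation in \<open>A\<close> the process at \<open>1\<close> would
      be \<open>- r * p\<close>, too large for the bound \<open>K\<close>. The entry 1 in the
      minimum in \<open>small\<close> serves this step.\<close>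
    have nA0: "0 < nA Z A n \<omega>"
    proof (rule ccontr)
      assume "\<not> 0 < nA Z A n \<omega>"
      then have "\<bar>process n 1 \<omega>\<bar> = r * p" using pA_pos by (simp add: process_one_eq r_def)
      then have "r * p \<le> K" using K(1)[OF one_unitcube] by simp
      moreover have "2 * K < p * r" using small r pA_pos by (simp add: r_def field_simps)
      ultimately show False using K(2) by (simp add: mult.commute)
    qed
    define Q where "Q k v \<longleftrightarrow> 0 < v \<and> v \<le> 1 \<and> Gninv M X Z A n k \<omega> (u $ k) = ereal v \<and>
      r * \<bar>v - u $ k\<bar> \<le> 2 * K / p \<and>
      \<bar>p * (r * (v - u $ k)) + (margin_process n k (u $ k) \<omega> - u $ k * process n 1 \<omega>)\<bar> \<le> \<epsilon>" for k v
    have "\<exists>v. Q k v" for k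
      unfolding Q_def r_def using small by (intro quantile_linearization[OF om n nA0 u0 md K(1)]) auto
    then obtain q where "\<And>k. Q k (q k)" by metis
    then have q: "\<And>k. 0 < q k" "\<And>k. q k \<le> 1"
      "\<And>k. Gninv M X Z A n k \<omega> (u $ k) = ereal (q k)" "\<And>k. r * \<bar>q k - u $ k\<bar> \<le> 2 * K / p"
      "\<And>k. \<bar>p * (r * (q k - u $ k)) + (margin_process n k (u $ k) \<omega> - u $ k * process n 1 \<omega>)\<bar> \<le> \<epsilon>"
      unfolding Q_def by blast+
    define v where "v = (\<chi> k. q k)"
    define \<gamma> where "\<gamma> k = margin_process n k (u $ k) \<omega> - u $ k * process n 1 \<omega>" for k
    have vc: "v \<in> unitcube" using q(1,2) by (auto simp: v_def unitcube_iff less_imp_le)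
    have close: "\<bar>q k - u $ k\<bar> < min (min \<delta>' 1) (min d \<delta>)" for k
    proof -
      have "\<bar>q k - u $ k\<bar> \<le> 2 * K / p / r"
        using q(4)[of k] r by (simp only: pos_le_divide_eq mult.commute)
      then show ?thesis using small unfolding r_def by linarith
    qed
    \<comment> \<open>The modulus compares the margin process with its value on the nearby face.
      What remains is the process at \<open>1\<close> with a factor at most
      \<open>2 * \<delta>\<close>.\<close>
    have gam: "\<bar>\<gamma> k\<bar> \<le> 2 * \<epsilon>" if "u $ k < 2 * \<delta> \<or> 1 - 2 * \<delta> < u $ k" for k
      using that
    proof
      assume lt: "u $ k < 2 * \<delta>"
      have "\<bar>margin_process n k (u $ k) \<omega> - margin_process n k 0 \<omega>\<bar> \<le> \<epsilon>"
        using u0[of k] lt del by (intro md[unfolded modulus_bound_def, rule_format] vupd_one_unitcube) auto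
      then have "\<bar>margin_process n k (u $ k) \<omega>\<bar> \<le> \<epsilon>" using process_zero[OF om, of "vupd 1 k 0" k n] by simp
      moreover have "\<bar>u $ k * process n 1 \<omega>\<bar> \<le> \<epsilon>"
      proof -
        have "\<bar>u $ k * process n 1 \<omega>\<bar> \<le> 2 * \<delta> * K"
          unfolding abs_mult using u0[of k] lt del K(1)[OF one_unitcube] by (intro mult_mono) auto
        then show ?thesis using del by linarith
      qed
      ultimately show ?thesis unfolding \<gamma>_def by linarith
    next
      assume gt: "1 - 2 * \<delta> < u $ k"
      have "\<bar>process n (vupd 1 k (u $ k)) \<omega> - process n 1 \<omega>\<bar> \<le> \<epsilon>"
        using u0[of k] gt del
        by (intro md[unfolded modulus_bound_def, rule_format] vupd_one_unitcube one_unitcube) auto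
      moreover have "\<bar>(1 - u $ k) * process n 1 \<omega>\<bar> \<le> \<epsilon>"
      proof -
        have "\<bar>(1 - u $ k) * process n 1 \<omega>\<bar> \<le> 2 * \<delta> * K"
          unfolding abs_mult using u0[of k] gt del K(1)[OF one_unitcube] by (intro mult_mono) auto
        then show ?thesis using del by linarith
      qed
      moreover have "\<gamma> k = (process n (vupd 1 k (u $ k)) \<omega> - process n 1 \<omega>) + (1 - u $ k) * process n 1 \<omega>"
        by (simp add: \<gamma>_def algebra_simps)
      ultimately show ?thesis by linarith
    qed
    define w where "w B = (\<chi> k. if k \<in> B then q k else u $ k)" for B
    have wc: "w B \<in> unitcube" for B
      using q(1,2) u0 by (auto simp: w_def unitcube_iff less_imp_le)
    \<comment> \<open>Induction on the set \<open>B\<close> of coordinates already moved from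
      \<open>u\<close> to the quantiles, which telescopes the increment of \<open>D\<close>.\<close>
    have tele: "\<bar>r * (D (w B) - D u) + (\<Sum>k\<in>B. 1 / p * (dD M X Z A k u * \<gamma> k))\<bar> \<le> real (card B) * (5 * \<epsilon>)" for B
    proof (induction B rule: finite_induct[OF finite])
      case 1
      have "w {} = u" by (simp add: w_def vec_eq_iff)
      then show ?case by simp
    next
      case (2 k B)
      have e: "w (insert k B) = vupd (w B) k (q k)" by (auto simp: w_def vec_eq_iff)
      have "\<bar>r * (D (vupd (w B) k (q k)) - D (w B)) + 1 / p * (dD M X Z A k u * \<gamma> k)\<bar> \<le> 5 * \<epsilon>"
      proof (rule coordinate_increment[OF C wc u u0(1), where d=d and \<delta>=\<delta> and L="2 * K / p" and \<epsilon>'="\<epsilon> / (2 * K / p)"])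
        show "w B $ k = u $ k" using 2 by (simp add: w_def)
        show "\<forall>j. \<bar>w B $ j - u $ j\<bar> \<le> d"
        proof
          fix j
          have "0 \<le> d" using close[of j] by linarith
          then show "\<bar>w B $ j - u $ j\<bar> \<le> d" using close[of j] by (auto simp: w_def)
        qed
        show "\<epsilon> / (2 * K / p) * (2 * K / p) \<le> \<epsilon>" using K(2) pA_pos by simp
        show "0 \<le> \<epsilon> / (2 * K / p)" using K(2) pA_pos eps by simp
        show "\<bar>p * (r * (q k - u $ k)) + \<gamma> k\<bar> \<le> \<epsilon>" using q(5)[of k] by (simp add: \<gamma>_def)
        show "\<gamma> k = 0" if "u $ k = 1"
          using that vupd_same[of "1 :: real^'p" k] by (simp add: \<gamma>_def)
      qed (use q close[of k] dm r gam[of k] del in \<open>auto\<close>)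
      moreover have "r * (D (w (insert k B)) - D u) + (\<Sum>k\<in>insert k B. 1 / p * (dD M X Z A k u * \<gamma> k)) =
        (r * (D (vupd (w B) k (q k)) - D (w B)) + 1 / p * (dD M X Z A k u * \<gamma> k)) +
        (r * (D (w B) - D u) + (\<Sum>k\<in>B. 1 / p * (dD M X Z A k u * \<gamma> k)))"
        using 2 by (simp add: e algebra_simps)
      moreover have "real (card (insert k B)) * (5 * \<epsilon>) = 5 * \<epsilon> + real (card B) * (5 * \<epsilon>)"
        using 2 by (simp add: algebra_simps)
      ultimately show ?case
        using "2.IH" by (simp only:)
    qed
    have "w UNIV = v" by (simp add: w_def v_def)
    with tele[of UNIV]
    have t: "\<bar>r * (D v - D u) + 1 / p * (\<Sum>k\<in>UNIV. dD M X Z A k u * \<gamma> k)\<bar> \<le> real CARD('p) * (5 * \<epsilon>)"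
      by (simp add: sum_distrib_left)
    have "\<bar>process n v \<omega> - process n u \<omega>\<bar> \<le> \<epsilon>"
      using vc u close by (intro md[unfolded modulus_bound_def, rule_format]) (auto simp: v_def less_imp_le)
    moreover have "DDbarn M X Z A n u \<omega> = process n v \<omega> + r * (D v - D u)"
    proof -
      have "Dbarn M X Z A n u \<omega> = Dn M X Z A n v \<omega>"
        by (simp add: Dbarn_def Dn_def q(3) v_def)
      then show ?thesis
        using DDn_eq_process[of n v \<omega>] by (simp add: DDbarn_def DDn_def r_def algebra_simps)
    qed
    moreover have "DDtilden M X Z A n u \<omega> = process n u \<omega> - 1 / p * (\<Sum>k\<in>UNIV. dD M X Z A k u * \<gamma> k)"
      by (simp add: DDtilden_eq \<gamma>_def)
    ultimately have "\<bar>DDbarn M X Z A n u \<omega> - DDtilden M X Z A n u \<omega>\<bar> \<le> \<epsilon> + real CARD('p) * (5 * \<epsilon>)"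
      using t by linarith
    then show ?thesis by (simp add: algebra_simps)
  qed
qed

section \<open>From the deterministic bound to convergence in probability\<close>

lemma modulus_bound_eventually:
  assumes "0 < \<epsilon>" "0 < \<eta>"
  obtains \<delta> N where "0 < \<delta>"
    "\<And>n. N \<le> n \<Longrightarrow> \<exists>B\<in>sets M. prob B < \<eta> \<and> (\<forall>\<omega>\<in>space M - B. modulus_bound n \<omega> \<delta> \<epsilon>)"
proof -
  obtain \<delta> N where "0 < \<delta>"
    and "\<And>n. N \<le> n \<Longrightarrow> \<exists>B\<in>sets M. prob B < \<eta> \<and> (\<forall>\<omega>\<in>space M - B. \<forall>u v.
        (\<forall>k. 0 \<le> u $ k \<and> u $ k \<le> 1) \<longrightarrow> (\<forall>k. 0 \<le> v $ k \<and> v $ k \<le> 1) \<longrightarrow>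
        (\<forall>k. \<bar>u $ k - v $ k\<bar> \<le> \<delta>) \<longrightarrow> \<bar>process n u \<omega> - process n v \<omega>\<bar> \<le> \<epsilon>)"
    using process_equicontinuous[OF assms] by blast
  moreover have "modulus_bound n \<omega> \<delta> \<epsilon> \<longleftrightarrow> (\<forall>u v.
        (\<forall>k. 0 \<le> u $ k \<and> u $ k \<le> 1) \<longrightarrow> (\<forall>k. 0 \<le> v $ k \<and> v $ k \<le> 1) \<longrightarrow>
        (\<forall>k. \<bar>u $ k - v $ k\<bar> \<le> \<delta>) \<longrightarrow> \<bar>process n u \<omega> - process n v \<omega>\<bar> \<le> \<epsilon>)" for n \<omega>
    unfolding modulus_bound_def Ball_def unitcube_iff by blast
  ultimately show ?thesis by (intro that[of \<delta> N]) simp_all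
qed

text \<open>The order of choices matters: the modulus at level 1 yields \<open>K\<close>, the
  modulus at level \<open>\<epsilon>\<close> yields \<open>\<delta>0\<close>, these determine
  \<open>\<delta>\<close>, then \<open>d\<close>, and finally how large \<open>n\<close> must
  be.\<close>

theorem remainder_to_zero:
  assumes C: "condC M X Z A"
  shows "to_zero_in_outer_prob M (\<lambda>n \<omega>.
           SUP u\<in>unitcube. \<bar>DDbarn M X Z A n u \<omega> - DDtilden M X Z A n u \<omega>\<bar>)"
  unfolding to_zero_in_outer_prob_def
proof (intro allI impI)
  fix e \<eta> :: real assume "0 < e" "0 < \<eta>"
  define \<epsilon> where "\<epsilon> = e / (5 * real CARD('p) + 1)"
  have eps: "0 < \<epsilon>" using \<open>0 < e\<close> by (simp add: \<epsilon>_def add_nonneg_pos)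
  obtain \<delta>1 N1 where d1: "0 < \<delta>1"
    "\<And>n. N1 \<le> n \<Longrightarrow> \<exists>B\<in>sets M. prob B < \<eta> / 2 \<and> (\<forall>\<omega>\<in>space M - B. modulus_bound n \<omega> \<delta>1 1)"
    using modulus_bound_eventually[of 1 "\<eta> / 2"] \<open>0 < \<eta>\<close> by auto
  obtain \<delta>0 N0 where d0: "0 < \<delta>0"
    "\<And>n. N0 \<le> n \<Longrightarrow> \<exists>B\<in>sets M. prob B < \<eta> / 2 \<and> (\<forall>\<omega>\<in>space M - B. modulus_bound n \<omega> \<delta>0 \<epsilon>)"
    using modulus_bound_eventually[OF eps, of "\<eta> / 2"] \<open>0 < \<eta>\<close> by auto
  \<comment> \<open>The number of steps from the origin in \<open>process_bounded\<close>, which is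
    also the bound on the process.\<close>
  obtain m where m: "0 < m" "1 / real m \<le> \<delta>1"
    using ex_inverse_of_nat_less[OF d1(1)] by (auto simp: inverse_eq_divide intro: less_imp_le)
  define K where "K = real m"
  have K: "0 < K" using m by (simp add: K_def)
  \<comment> \<open>The first entry makes the boundary strips narrow enough for the modulus, the
    second makes \<open>2 * \<delta> * K\<close> at most \<open>\<epsilon>\<close>.\<close>
  define \<delta> where "\<delta> = min (\<delta>0 / 2) (\<epsilon> / (2 * K))"
  have del: "0 < \<delta>" "2 * \<delta> \<le> \<delta>0" using d0(1) eps K by (auto simp: \<delta>_def)
  have delK: "2 * \<delta> * K \<le> \<epsilon>"
  proof -
    have "2 * \<delta> * K \<le> 2 * (\<epsilon> / (2 * K)) * K" using K by (intro mult_right_mono) (auto simp: \<delta>_def)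
    then show ?thesis using K by simp
  qed
  have "0 < \<epsilon> / (2 * K / p)" using eps K pA_pos by simp
  then obtain d where d: "0 < d" "dD_modulus \<delta> d (\<epsilon> / (2 * K / p))"
    using dD_modulus_exists[OF C del(1)] by blast
  have "(\<lambda>n. 2 * K / p / sqrt (real n)) \<longlonglongrightarrow> 0"
    by (intro real_tendsto_divide_at_top[OF tendsto_const]
      filterlim_compose[OF sqrt_at_top] filterlim_real_sequentially)
  moreover have "0 < min (min \<delta>0 1) (min d \<delta>)" using d0(1) d(1) del(1) by simp
  ultimately have "\<forall>\<^sub>F n in sequentially. 2 * K / p / sqrt (real n) < min (min \<delta>0 1) (min d \<delta>)"
    by (rule order_tendstoD(2))
  then obtain N2 where N2: "\<And>n. N2 \<le> n \<Longrightarrow> 2 * K / p / sqrt (real n) < min (min \<delta>0 1) (min d \<delta>)"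
    by (auto simp: eventually_sequentially)
  show "\<exists>N. \<forall>n\<ge>N. \<exists>B\<in>sets M. {\<omega> \<in> space M. e < \<bar>SUP u\<in>unitcube.
      \<bar>DDbarn M X Z A n u \<omega> - DDtilden M X Z A n u \<omega>\<bar>\<bar>} \<subseteq> B \<and> prob B < \<eta>"
  proof (intro exI[of _ "Max {N0, N1, N2, 1}"] allI impI)
    fix n assume "Max {N0, N1, N2, 1} \<le> n"
    then have n: "N0 \<le> n" "N1 \<le> n" "N2 \<le> n" "0 < n" by auto
    obtain B0 where B0: "B0 \<in> sets M" "prob B0 < \<eta> / 2" "\<And>\<omega>. \<omega> \<in> space M - B0 \<Longrightarrow> modulus_bound n \<omega> \<delta>0 \<epsilon>"
      using d0(2)[OF n(1)] by blast
    obtain B1 where B1: "B1 \<in> sets M" "prob B1 < \<eta> / 2" "\<And>\<omega>. \<omega> \<in> space M - B1 \<Longrightarrow> modulus_bound n \<omega> \<delta>1 1"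
      using d1(2)[OF n(2)] by blast
    let ?B = "B0 \<union> B1 \<union> null_event"
    have "prob ?B \<le> prob B0 + prob B1 + prob null_event"
      using measure_Un_le[of "B0 \<union> B1" M null_event] measure_Un_le[of B0 M B1] B0(1) B1(1) by auto
    then have pB: "prob ?B < \<eta>" using B0(2) B1(2) prob_null_event by simp
    have sup: "\<bar>SUP u\<in>unitcube. \<bar>DDbarn M X Z A n u \<omega> - DDtilden M X Z A n u \<omega>\<bar>\<bar> \<le> e"
      if om: "\<omega> \<in> space M" "\<omega> \<notin> ?B" for \<omega>
    proof -
      have bd: "\<bar>DDbarn M X Z A n u \<omega> - DDtilden M X Z A n u \<omega>\<bar> \<le> e" if u: "u \<in> unitcube" for u
      proof -
        have "\<bar>process n w \<omega>\<bar> \<le> K" if "w \<in> unitcube" for w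
          unfolding K_def using om B1(3)[of \<omega>] m that by (intro process_bounded) auto
        then have "\<bar>DDbarn M X Z A n u \<omega> - DDtilden M X Z A n u \<omega>\<bar> \<le> (5 * real CARD('p) + 1) * \<epsilon>"
          using om B0(3)[of \<omega>] n(4) K d(2) del delK N2[OF n(3)] u
          by (intro remainder_bound[OF C, where K=K and d=d and \<delta>=\<delta> and \<delta>'=\<delta>0]) auto
        also have "\<dots> = e" by (simp add: \<epsilon>_def add_nonneg_pos less_imp_neq[THEN not_sym])
        finally show ?thesis .
      qed
      have ne: "(1 :: real^'p) \<in> unitcube" by (rule one_unitcube)
      have "(SUP u\<in>unitcube. \<bar>DDbarn M X Z A n u \<omega> - DDtilden M X Z A n u \<omega>\<bar>) \<le> e"
        using ne bd by (intro cSUP_least) auto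
      \<comment> \<open>A real \<open>SUP\<close> is meaningful only for a bounded family;
        \<open>bd\<close> supplies the bound for this outcome.\<close>
      moreover have "0 \<le> (SUP u\<in>unitcube. \<bar>DDbarn M X Z A n u \<omega> - DDtilden M X Z A n u \<omega>\<bar>)"
        using ne bd by (intro cSUP_upper2[where x=1]) (auto intro!: bdd_aboveI2)
      ultimately show ?thesis by simp
    qed
    show "\<exists>B\<in>sets M. {\<omega> \<in> space M. e < \<bar>SUP u\<in>unitcube.
        \<bar>DDbarn M X Z A n u \<omega> - DDtilden M X Z A n u \<omega>\<bar>\<bar>} \<subseteq> B \<and> prob B < \<eta>"
    proof (intro bexI[of _ ?B] conjI subsetI)
      fix \<omega> assume om: "\<omega> \<in> {\<omega> \<in> space M. e < \<bar>SUP u\<in>unitcube.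
        \<bar>DDbarn M X Z A n u \<omega> - DDtilden M X Z A n u \<omega>\<bar>\<bar>}"
      show "\<omega> \<in> ?B"
      proof (rule ccontr)
        assume "\<omega> \<notin> ?B"
        then show False using sup[of \<omega>] om by simp
      qed
    qed (use B0(1) B1(1) pB in auto)
  qed
qed

end

theorem theorem1:
  fixes M :: "'a measure"
    and X :: "nat \<Rightarrow> 'a \<Rightarrow> real^'p"
    and Z :: "nat \<Rightarrow> 'a \<Rightarrow> real^'q"
    and A :: "(real^'q) set"
  assumes "prob_space M"
    and "\<And>i. (\<lambda>\<omega>. (X i \<omega>, Z i \<omega>)) \<in> borel_measurable M"
    and "prob_space.indep_vars M (\<lambda>_. borel) (\<lambda>i \<omega>. (X i \<omega>, Z i \<omega>)) UNIV"
    and "\<And>i. distr M borel (\<lambda>\<omega>. (X i \<omega>, Z i \<omega>)) = distr M borel (\<lambda>\<omega>. (X 0 \<omega>, Z 0 \<omega>))"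
    and "A \<in> sets borel"
    and "pA M Z A > 0"
    and "\<And>k. continuous_on UNIV (condF M X Z A k)"
    and "condC M X Z A"
  shows "to_zero_in_outer_prob M (\<lambda>n \<omega>.
           SUP u\<in>unitcube. \<bar>DDbarn M X Z A n u \<omega> - DDtilden M X Z A n u \<omega>\<bar>)"
proof -
  interpret prob_space M by fact
  interpret conditional_sample M X Z A
    by unfold_locales (fact assms)+
  show ?thesis using assms(8) by (rule remainder_to_zero)
qed

end
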